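(* (Completeness theorem 1) Consider $\mathfrak M$-valued logic over a finite De Morgan algebra $\mathfrak M$ with universe $M$. (a) Every consistent set of formulas has a model. (b) For every $Q\subseteq M$, every $Q$-consistent set of formulas has a $Q$-model.
   Context: **De Morgan algebra.** $\mathfrak M=\langle M,+,\cdot,-,0,1\rangle$ is a finite De Morgan algebra with $0\neq 1$: $+$ and $\cdot$ are commutative, associative, each distributes over the other, $x+0=x$, $x\cdot 1=x$, $x\cdot(x+y)=x=x+(x\cdot y)$, $-(x+y)=-x\cdot -y$, $-(x\cdot y)=-x+-y$, $--x=x$. $x\le y$ iff $x\cdot y=x$. Whenever $\sup A$ is written, $A$ ranges over nonempty subsets of $M$, and $\sup A$ is the $+$-sum of its elements. **Syntax.** Symbols: variables $v_k$ ($k\in\omega$), $n_i$-ary relation symbols $R_i$ ($i\in I$, $I\ne\emptyset$), $\approx$, $\neg$, $\wedge$, $\vee$, $\exists$, and $\gamma_p$, $t_p$ for $p\in M$. Formulas: $R_iv_{k_0}\cdots v_{k_{n_i-1}}$, $v_j\approx v_k$, $t_p$ are formulas; if $\phi,\theta$ are formulas so are $\neg\phi$, $(\phi\wedge\theta)$, $(\phi\vee\theta)$, $\exists v_k\phi$, $\gamma_p\phi$. $Fv(\phi)$ is the set of indices of free variables: $Fv(t_p)=\emptyset$, $Fv(v_i\approx v_j)=\{i,j\}$, $Fv(R_iv_{k_0}\cdots v_{k_{n_i-1}})=\{k_0,\dots,k_{n_i-1}\}$, $Fv(\neg\phi)=Fv(\gamma_p\phi)=Fv(\phi)$, $Fv(\phi\wedge\theta)=Fv(\phi\vee\theta)=Fv(\phi)\cup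 Fv(\theta)$, $Fv(\exists v_k\phi)=Fv(\phi)\setminus\{k\}$. Abbreviations ($\bigvee,\bigwedge$ over finite index sets are iterated $\vee,\wedge$ in some fixed order and bracketing; an empty $\bigvee$ is $t_0$): $\theta\rightarrow\phi$ is $\neg\theta\vee\phi$; $\theta\Rightarrow\phi$ is $\bigwedge_{r\in M}(\gamma_r\phi\rightarrow\bigvee_{q\le r}\gamma_q\theta)$; $\theta\Leftrightarrow\phi$ is $(\theta\Rightarrow\phi)\wedge(\phi\Rightarrow\theta)$; $\forall v_k\phi$ is $\neg\exists v_k\neg\phi$; $\Gamma\phi$ is $\gamma_0\phi\vee\gamma_1\phi$; $S^k_l\phi$ is $\exists v_k(v_k\approx v_l\wedge\phi)$. For $Q\subseteq M$, $\phi^Q$ is $\bigvee_{p\in Q}\gamma_p\phi$ and $\Sigma^Q=\{\phi^Q:\phi\in\Sigma\}$. **Semantics.** An $\mathfrak M$-structure is $\mathfrak A=\langle U,P_i\rangle_{i\in I}$ with $U\ne\emptyset$ and each $P_i:M\to\mathcal P(U^{n_i})$ such that the sets $P_i^q$ ($q\in M$) are pairwise disjoint with union $U^{n_i}$. Each formula $\phi$ gets $\phi^{\mathfrak A}:M\to\mathcal P(U^\omega)$, with $q$-component $(\phi^{\mathfrak A})^q$: $((R_iv_{k_0}\cdots v_{k_{n_i-1}})^{\mathfrak A})^q=\{s:(s_{k_0},\dots,s_{k_{n_i-1}})\in P_i^q\}$; $((v_j\approx v_k)^{\mathfrak A})^p$ is $\{s:s_j=s_k\}$ if $p=1$, its complement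 if $p=0$, $\emptyset$ otherwise; $(t_p^{\mathfrak A})^q=U^\omega$ if $q=p$, else $\emptyset$; $((\phi\vee\theta)^{\mathfrak A})^p=\bigcup_{q+r=p}(\phi^{\mathfrak A})^q\cap(\theta^{\mathfrak A})^r$; $((\phi\wedge\theta)^{\mathfrak A})^p=\bigcup_{q\cdot r=p}(\phi^{\mathfrak A})^q\cap(\theta^{\mathfrak A})^r$; $((\neg\phi)^{\mathfrak A})^p=(\phi^{\mathfrak A})^{-p}$; $((\exists v_k\phi)^{\mathfrak A})^p=\bigcup_{\sup A=p}\bigcap_{q\in A}C_k(\phi^{\mathfrak A})^q\setminus\bigcup_{\sup A>p}\bigcap_{q\in A}C_k(\phi^{\mathfrak A})^q$, where $C_kX=\{s\in U^\omega:$ changing the $k$-th entry of $s$ to some $x\in U$ gives a member of $X\}$; $((\gamma_p\phi)^{\mathfrak A})^q$ is $(\phi^{\mathfrak A})^p$ if $q=1$, its complement if $q=0$, $\emptyset$ otherwise. $\phi$ is true in $\mathfrak A$ if $(\phi^{\mathfrak A})^1=U^\omega$; $\phi$ is $Q$-true in $\mathfrak A$ if $\bigcup_{p\in Q}(\phi^{\mathfrak A})^p=U^\omega$. $\mathfrak A$ is a model (resp. $Q$-model) of $\Sigma$ if every $\phi\in\Sigma$ is true (resp. $Q$-true) in $\mathfrak A$. **Tautologies.** Prime formulas are those of the forms $\exists v_k\phi$, $v_j\approx v_k$, $R_iv_{k_0}\cdots v_{k_{n_i-1}}$; $\mathbb P$ is the set of them. For $v:\mathbb P\to M$ define $T(\phi,v)\in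 M$: $T(\phi,v)=v(\phi)$ for $\phi\in\mathbb P$; $T(\phi\vee\theta,v)=T(\phi,v)+T(\theta,v)$; $T(\phi\wedge\theta,v)=T(\phi,v)\cdot T(\theta,v)$; $T(\neg\phi,v)=-T(\phi,v)$; $T(t_p,v)=p$; $T(\gamma_p\phi,v)=1$ if $T(\phi,v)=p$, else $0$. $\phi$ is a tautology if $T(\phi,v)=1$ for all $v$. **Proof system.** Axioms: all tautologies, and all formulas of the following forms: 1. $\Gamma\forall v_k\phi\rightarrow(\forall v_k\phi\rightarrow\phi)$; 2. $\gamma_1\exists v_k\gamma_1\phi\Leftrightarrow\exists v_k\gamma_1\phi$; 3. $\gamma_1(v_k\approx v_l)\Leftrightarrow v_k\approx v_l$; 4. $\gamma_p(v_k\approx v_l)\Leftrightarrow t_0$ if $p\notin\{0,1\}$; 5. $\gamma_0(v_k\approx v_l)\Leftrightarrow\neg v_k\approx v_l$; 6. $\exists v_kt_0\Leftrightarrow t_0$; 7. $\phi\vee\exists v_k\phi\Leftrightarrow\exists v_k\phi$; 8. $\exists v_k(\phi\wedge\exists v_k\theta)\Leftrightarrow\exists v_k\phi\wedge\exists v_k\theta$; 9. $\exists v_k\exists v_l\phi\Leftrightarrow\exists v_l\exists v_k\phi$; 10. $v_k\approx v_k\Leftrightarrow t_1$; 11. $v_l\approx v_m\Leftrightarrow\exists v_k(v_l\approx v_k\wedge v_k\approx v_m)$ if $k\notin\{l,m\}$; 12. $\exists v_k(v_k\approx v_l\wedge\gamma_1\phi)\wedge\exists v_k(v_k\approx v_l\wedge\neg\gamma_1\phi)\Leftrightarrow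 t_0$ if $k\neq l$; 13. $\gamma_p(\exists v_k\phi)\Leftrightarrow\big(\bigvee_{\sup A=p}\bigwedge_{q\in A}\exists v_k\gamma_q\phi\big)\wedge\neg\big(\bigvee_{\sup A>p}\bigwedge_{q\in A}\exists v_k\gamma_q\phi\big)$; 14. $R_iv_{j_0}\cdots v_{j_{n_i-1}}\Leftrightarrow S^{k_0}_{j_0}\cdots S^{k_{n_i-1}}_{j_{n_i-1}}S^0_{k_0}\cdots S^{n_i-1}_{k_{n_i-1}}R_iv_0\cdots v_{n_i-1}$ where the $k_m$ are distinct and $k_m\notin\{0,\dots,n_i-1,j_0,\dots,j_{n_i-1}\}$ for $m<n_i$. Rules: (Modus Ponens) from $\phi$ and $\phi\rightarrow\theta$ infer $\theta$; ($\Gamma$-rule) from $\phi$ infer $\Gamma\phi$; ($\exists$-rule) from $\theta\Rightarrow\phi$ infer $\exists v_k\theta\Rightarrow\phi$ if $k\notin Fv(\phi)$. $\Sigma\vdash\phi$ means there is a finite sequence of formulas ending in $\phi$, each of which is in $\Sigma$, is an axiom, or follows from earlier ones by a rule. $\Sigma\vdash_Q\phi$ means $\Sigma^Q\vdash\phi^Q$. $\Sigma$ is consistent if not $\Sigma\vdash t_0$; $\Sigma$ is $Q$-consistent if not $\Sigma\vdash_Qt_0$. *)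

theory Defs
  imports Main
begin

section \<open>De Morgan algebras\<close>

class de_morgan_algebra =
  comm_monoid_add + comm_monoid_mult + zero_neq_one + uminus + ord +
  assumes mult_add_distrib: "x * (y + z) = x * y + x * z"
    and add_mult_distrib: "x + y * z = (x + y) * (x + z)"
    and mult_absorb: "x * (x + y) = x"
    and add_absorb: "x + x * y = x"
    and uminus_add: "- (x + y) = - x * - y"
    and uminus_mult: "- (x * y) = - x + - y"
    and uminus_uminus: "- (- x) = x"
    and less_eq_iff_mult: "x \<le> y \<longleftrightarrow> x * y = x"
    and less_iff: "x < y \<longleftrightarrow> x \<le> y \<and> x \<noteq> y"
begin

subclass order
proof
  fix x y z
  have idem: "x * x = x" for x
    by (metis mult_absorb add_absorb)
  show "x < y \<longleftrightarrow> x \<le> y \<and> \<not> y \<le> x"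
    by (metis less_iff less_eq_iff_mult mult.commute idem)
  show "x \<le> x"
    by (simp add: less_eq_iff_mult idem)
  show "x \<le> y \<Longrightarrow> y \<le> z \<Longrightarrow> x \<le> z"
    by (metis less_eq_iff_mult mult.assoc)
  show "x \<le> y \<Longrightarrow> y \<le> x \<Longrightarrow> x = y"
    by (metis less_eq_iff_mult mult.commute)
qed

end


section \<open>Syntax\<close>

text \<open>
  The truth values are the elements of the type \<open>'m\<close> and the relation symbols those of
  the type \<open>'i\<close>; the variable \<open>v\<^sub>k\<close> is represented by its index \<open>k\<close>. The arity of the
  relation symbols is not part of the type; it is enforced by \<open>is_formula\<close>.
\<close>

datatype ('m, 'i) fm =
    Rel 'i "nat list"
  | Eq nat nat  (infix "\<^bold>\<approx>" 75)
  | Val 'm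
  | Neg "('m, 'i) fm"  ("\<^bold>\<not> _" [70] 70)
  | And "('m, 'i) fm" "('m, 'i) fm"  (infixr "\<^bold>\<and>" 65)
  | Or "('m, 'i) fm" "('m, 'i) fm"  (infixr "\<^bold>\<or>" 63)
  | Exi nat "('m, 'i) fm"
  | Gam 'm "('m, 'i) fm"

primrec is_formula :: "('i \<Rightarrow> nat) \<Rightarrow> ('m, 'i) fm \<Rightarrow> bool" where
  "is_formula ar (Rel i ks) \<longleftrightarrow> length ks = ar i"
| "is_formula ar (j \<^bold>\<approx> k) \<longleftrightarrow> True"
| "is_formula ar (Val p) \<longleftrightarrow> True"
| "is_formula ar (\<^bold>\<not> \<phi>) \<longleftrightarrow> is_formula ar \<phi>"
| "is_formula ar (\<phi> \<^bold>\<and> \<theta>) \<longleftrightarrow> is_formula ar \<phi> \<and> is_formula ar \<theta>"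
| "is_formula ar (\<phi> \<^bold>\<or> \<theta>) \<longleftrightarrow> is_formula ar \<phi> \<and> is_formula ar \<theta>"
| "is_formula ar (Exi k \<phi>) \<longleftrightarrow> is_formula ar \<phi>"
| "is_formula ar (Gam p \<phi>) \<longleftrightarrow> is_formula ar \<phi>"

primrec Fv :: "('m, 'i) fm \<Rightarrow> nat set" where
  "Fv (Rel i ks) = set ks"
| "Fv (j \<^bold>\<approx> k) = {j, k}"
| "Fv (Val p) = {}"
| "Fv (\<^bold>\<not> \<phi>) = Fv \<phi>"
| "Fv (\<phi> \<^bold>\<and> \<theta>) = Fv \<phi> \<union> Fv \<theta>"
| "Fv (\<phi> \<^bold>\<or> \<theta>) = Fv \<phi> \<union> Fv \<theta>"
| "Fv (Exi k \<phi>) = Fv \<phi> - {k}"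
| "Fv (Gam p \<phi>) = Fv \<phi>"

text \<open>
  Iterated disjunctions and conjunctions over a finite index set are taken in a fixed,
  arbitrarily chosen order and bracketed to the right. The empty conjunction is never
  used; its value is only there to make the function total.
\<close>

definition listing :: "'a set \<Rightarrow> 'a list" where
  "listing A = (SOME xs. distinct xs \<and> set xs = A)"

fun or_list :: "('m::zero, 'i) fm list \<Rightarrow> ('m, 'i) fm" where
  "or_list [] = Val 0"
| "or_list [\<phi>] = \<phi>"
| "or_list (\<phi> # \<theta> # xs) = \<phi> \<^bold>\<or> or_list (\<theta> # xs)"

fun and_list :: "('m::one, 'i) fm list \<Rightarrow> ('m, 'i) fm" where
  "and_list [] = Val 1"
| "and_list [\<phi>] = \<phi>"
| "and_list (\<phi> # \<theta> # xs) = \<phi> \<^bold>\<and> and_list (\<theta> # xs)"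

definition BigOr :: "'a set \<Rightarrow> ('a \<Rightarrow> ('m::zero, 'i) fm) \<Rightarrow> ('m, 'i) fm" where
  "BigOr A f = or_list (map f (listing A))"

definition BigAnd :: "'a set \<Rightarrow> ('a \<Rightarrow> ('m::one, 'i) fm) \<Rightarrow> ('m, 'i) fm" where
  "BigAnd A f = and_list (map f (listing A))"

definition Imp :: "('m, 'i) fm \<Rightarrow> ('m, 'i) fm \<Rightarrow> ('m, 'i) fm"  (infixr "\<^bold>\<longrightarrow>" 60) where
  "\<theta> \<^bold>\<longrightarrow> \<phi> = (\<^bold>\<not> \<theta>) \<^bold>\<or> \<phi>"

definition Below :: "('m::de_morgan_algebra, 'i) fm \<Rightarrow> ('m, 'i) fm \<Rightarrow> ('m, 'i) fm"
    (infix "\<^bold>\<Rightarrow>" 55) where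
  "\<theta> \<^bold>\<Rightarrow> \<phi> = BigAnd UNIV (\<lambda>r. Gam r \<phi> \<^bold>\<longrightarrow> BigOr {q. q \<le> r} (\<lambda>q. Gam q \<theta>))"

definition Same :: "('m::de_morgan_algebra, 'i) fm \<Rightarrow> ('m, 'i) fm \<Rightarrow> ('m, 'i) fm"
    (infix "\<^bold>\<Leftrightarrow>" 55) where
  "\<theta> \<^bold>\<Leftrightarrow> \<phi> = (\<theta> \<^bold>\<Rightarrow> \<phi>) \<^bold>\<and> (\<phi> \<^bold>\<Rightarrow> \<theta>)"

definition Forall :: "nat \<Rightarrow> ('m, 'i) fm \<Rightarrow> ('m, 'i) fm" where
  "Forall k \<phi> = (\<^bold>\<not> (Exi k (\<^bold>\<not> \<phi>)))"

definition Crisp :: "('m::{zero,one}, 'i) fm \<Rightarrow> ('m, 'i) fm"  ("\<^bold>\<Gamma>") where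
  "\<^bold>\<Gamma> \<phi> = Gam 0 \<phi> \<^bold>\<or> Gam 1 \<phi>"

definition Subst :: "nat \<Rightarrow> nat \<Rightarrow> ('m, 'i) fm \<Rightarrow> ('m, 'i) fm" where
  "Subst k l \<phi> = Exi k (k \<^bold>\<approx> l \<^bold>\<and> \<phi>)"

definition relativize :: "'m set \<Rightarrow> ('m::zero, 'i) fm \<Rightarrow> ('m, 'i) fm" where
  "relativize Q \<phi> = BigOr Q (\<lambda>p. Gam p \<phi>)"


section \<open>Semantics\<close>

text \<open>
  A structure is given by its universe \<open>U\<close>, a subset of a type \<open>'u\<close>, and by the family \<open>P\<close>
  of interpretations; an element of \<open>U\<^sup>n\<close> is a list of length \<open>n\<close>, an element of \<open>U\<^sup>\<omega>\<close> a
  function from the natural numbers with values in \<open>U\<close>.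
\<close>

definition is_structure ::
    "('i \<Rightarrow> nat) \<Rightarrow> 'u set \<Rightarrow> ('i \<Rightarrow> 'm \<Rightarrow> 'u list set) \<Rightarrow> bool" where
  "is_structure ar U P \<longleftrightarrow>
     U \<noteq> {} \<and>
     (\<forall>i. (\<forall>p q. p \<noteq> q \<longrightarrow> P i p \<inter> P i q = {}) \<and>
          (\<Union>q. P i q) = {xs. length xs = ar i \<and> set xs \<subseteq> U})"

definition seqs :: "'u set \<Rightarrow> (nat \<Rightarrow> 'u) set" where
  "seqs U = {s. \<forall>k. s k \<in> U}"

definition cyl :: "'u set \<Rightarrow> nat \<Rightarrow> (nat \<Rightarrow> 'u) set \<Rightarrow> (nat \<Rightarrow> 'u) set" where
  "cyl U k X = {s \<in> seqs U. \<exists>x\<in>U. s(k := x) \<in> X}"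

text \<open>
  \<open>sem U P \<phi> q\<close> is the \<open>q\<close>-component of the interpretation of \<open>\<phi>\<close>. The supremum of a
  nonempty set \<open>A\<close> of truth values is its sum \<open>\<Sum>A\<close>.
\<close>

primrec sem :: "'u set \<Rightarrow> ('i \<Rightarrow> 'm \<Rightarrow> 'u list set) \<Rightarrow> ('m::de_morgan_algebra, 'i) fm
    \<Rightarrow> 'm \<Rightarrow> (nat \<Rightarrow> 'u) set" where
  "sem U P (Rel i ks) = (\<lambda>q. {s \<in> seqs U. map s ks \<in> P i q})"
| "sem U P (j \<^bold>\<approx> k) = (\<lambda>p.
     if p = 1 then {s \<in> seqs U. s j = s k}
     else if p = 0 then seqs U - {s \<in> seqs U. s j = s k}
     else {})"
| "sem U P (Val p) = (\<lambda>q. if q = p then seqs U else {})"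
| "sem U P (\<^bold>\<not> \<phi>) = (\<lambda>p. sem U P \<phi> (- p))"
| "sem U P (\<phi> \<^bold>\<and> \<theta>) = (\<lambda>p. \<Union>(q, r) \<in> {(q, r). q * r = p}. sem U P \<phi> q \<inter> sem U P \<theta> r)"
| "sem U P (\<phi> \<^bold>\<or> \<theta>) = (\<lambda>p. \<Union>(q, r) \<in> {(q, r). q + r = p}. sem U P \<phi> q \<inter> sem U P \<theta> r)"
| "sem U P (Exi k \<phi>) = (\<lambda>p.
     (\<Union>A \<in> {A. A \<noteq> {} \<and> \<Sum>A = p}. \<Inter>q\<in>A. cyl U k (sem U P \<phi> q)) -
     (\<Union>A \<in> {A. A \<noteq> {} \<and> \<Sum>A > p}. \<Inter>q\<in>A. cyl U k (sem U P \<phi> q)))"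
| "sem U P (Gam p \<phi>) = (\<lambda>q.
     if q = 1 then sem U P \<phi> p
     else if q = 0 then seqs U - sem U P \<phi> p
     else {})"

definition true_in :: "'u set \<Rightarrow> ('i \<Rightarrow> 'm \<Rightarrow> 'u list set) \<Rightarrow> ('m::de_morgan_algebra, 'i) fm
    \<Rightarrow> bool" where
  "true_in U P \<phi> \<longleftrightarrow> sem U P \<phi> 1 = seqs U"

definition Q_true_in :: "'m set \<Rightarrow> 'u set \<Rightarrow> ('i \<Rightarrow> 'm \<Rightarrow> 'u list set)
    \<Rightarrow> ('m::de_morgan_algebra, 'i) fm \<Rightarrow> bool" where
  "Q_true_in Q U P \<phi> \<longleftrightarrow> (\<Union>p\<in>Q. sem U P \<phi> p) = seqs U"

definition is_model :: "('i \<Rightarrow> nat) \<Rightarrow> 'u set \<Rightarrow> ('i \<Rightarrow> 'm \<Rightarrow> 'u list set)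
    \<Rightarrow> ('m::de_morgan_algebra, 'i) fm set \<Rightarrow> bool" where
  "is_model ar U P \<Sigma> \<longleftrightarrow> is_structure ar U P \<and> (\<forall>\<phi>\<in>\<Sigma>. true_in U P \<phi>)"

definition is_Q_model :: "('i \<Rightarrow> nat) \<Rightarrow> 'm set \<Rightarrow> 'u set \<Rightarrow> ('i \<Rightarrow> 'm \<Rightarrow> 'u list set)
    \<Rightarrow> ('m::de_morgan_algebra, 'i) fm set \<Rightarrow> bool" where
  "is_Q_model ar Q U P \<Sigma> \<longleftrightarrow> is_structure ar U P \<and> (\<forall>\<phi>\<in>\<Sigma>. Q_true_in Q U P \<phi>)"


section \<open>Tautologies\<close>

text \<open>
  A valuation of the prime formulas is represented by a total function, of which only the
  values at prime formulas (relational formulas, equations, existential formulas) are used.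
\<close>

primrec tval :: "('m::de_morgan_algebra, 'i) fm \<Rightarrow> (('m, 'i) fm \<Rightarrow> 'm) \<Rightarrow> 'm" where
  "tval (Rel i ks) v = v (Rel i ks)"
| "tval (j \<^bold>\<approx> k) v = v (j \<^bold>\<approx> k)"
| "tval (Val p) v = p"
| "tval (\<^bold>\<not> \<phi>) v = - tval \<phi> v"
| "tval (\<phi> \<^bold>\<and> \<theta>) v = tval \<phi> v * tval \<theta> v"
| "tval (\<phi> \<^bold>\<or> \<theta>) v = tval \<phi> v + tval \<theta> v"
| "tval (Exi k \<phi>) v = v (Exi k \<phi>)"
| "tval (Gam p \<phi>) v = (if tval \<phi> v = p then 1 else 0)"

definition tautology :: "('m::de_morgan_algebra, 'i) fm \<Rightarrow> bool" where
  "tautology \<phi> \<longleftrightarrow> (\<forall>v. tval \<phi> v = 1)"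


section \<open>Proof system\<close>

text \<open>
  The schemata do not require their instances to respect the arities; this is imposed on
  every member of a derivation in \<open>is_derivation\<close>.
\<close>

inductive is_axiom :: "('i \<Rightarrow> nat) \<Rightarrow> ('m::de_morgan_algebra, 'i) fm \<Rightarrow> bool"
  for ar :: "'i \<Rightarrow> nat" where
  ax_taut: "tautology \<phi> \<Longrightarrow> is_axiom ar \<phi>"
| ax1: "is_axiom ar (\<^bold>\<Gamma> (Forall k \<phi>) \<^bold>\<longrightarrow> (Forall k \<phi> \<^bold>\<longrightarrow> \<phi>))"
| ax2: "is_axiom ar (Gam 1 (Exi k (Gam 1 \<phi>)) \<^bold>\<Leftrightarrow> Exi k (Gam 1 \<phi>))"
| ax3: "is_axiom ar (Gam 1 (k \<^bold>\<approx> l) \<^bold>\<Leftrightarrow> (k \<^bold>\<approx> l))"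
| ax4: "p \<notin> {0, 1} \<Longrightarrow> is_axiom ar (Gam p (k \<^bold>\<approx> l) \<^bold>\<Leftrightarrow> Val 0)"
| ax5: "is_axiom ar (Gam 0 (k \<^bold>\<approx> l) \<^bold>\<Leftrightarrow> (\<^bold>\<not> (k \<^bold>\<approx> l)))"
| ax6: "is_axiom ar (Exi k (Val 0) \<^bold>\<Leftrightarrow> Val 0)"
| ax7: "is_axiom ar ((\<phi> \<^bold>\<or> Exi k \<phi>) \<^bold>\<Leftrightarrow> Exi k \<phi>)"
| ax8: "is_axiom ar (Exi k (\<phi> \<^bold>\<and> Exi k \<theta>) \<^bold>\<Leftrightarrow> (Exi k \<phi> \<^bold>\<and> Exi k \<theta>))"
| ax9: "is_axiom ar (Exi k (Exi l \<phi>) \<^bold>\<Leftrightarrow> Exi l (Exi k \<phi>))"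
| ax10: "is_axiom ar ((k \<^bold>\<approx> k) \<^bold>\<Leftrightarrow> Val 1)"
| ax11: "k \<notin> {l, m} \<Longrightarrow>
    is_axiom ar ((l \<^bold>\<approx> m) \<^bold>\<Leftrightarrow> Exi k ((l \<^bold>\<approx> k) \<^bold>\<and> (k \<^bold>\<approx> m)))"
| ax12: "k \<noteq> l \<Longrightarrow>
    is_axiom ar ((Exi k ((k \<^bold>\<approx> l) \<^bold>\<and> Gam 1 \<phi>) \<^bold>\<and>
                  Exi k ((k \<^bold>\<approx> l) \<^bold>\<and> (\<^bold>\<not> (Gam 1 \<phi>)))) \<^bold>\<Leftrightarrow> Val 0)"
| ax13: "is_axiom ar (Gam p (Exi k \<phi>) \<^bold>\<Leftrightarrow>
    (BigOr {A. A \<noteq> {} \<and> \<Sum>A = p} (\<lambda>A. BigAnd A (\<lambda>q. Exi k (Gam q \<phi>))) \<^bold>\<and>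
     (\<^bold>\<not> (BigOr {A. A \<noteq> {} \<and> \<Sum>A > p} (\<lambda>A. BigAnd A (\<lambda>q. Exi k (Gam q \<phi>)))))))"
| ax14: "length js = ar i \<Longrightarrow> length ks = ar i \<Longrightarrow> distinct ks \<Longrightarrow>
    set ks \<inter> ({0..<ar i} \<union> set js) = {} \<Longrightarrow>
    is_axiom ar (Rel i js \<^bold>\<Leftrightarrow>
      foldr (\<lambda>(k, j). Subst k j) (zip ks js)
        (foldr (\<lambda>(m, k). Subst m k) (zip [0..<ar i] ks) (Rel i [0..<ar i])))"

definition is_derivation :: "('i \<Rightarrow> nat) \<Rightarrow> ('m::de_morgan_algebra, 'i) fm set
    \<Rightarrow> ('m, 'i) fm list \<Rightarrow> bool" where
  "is_derivation ar \<Sigma> d \<longleftrightarrow>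
     (\<forall>n < length d.
        is_formula ar (d ! n) \<and>
        (d ! n \<in> \<Sigma> \<or>
         is_axiom ar (d ! n) \<or>
         (\<exists>a<n. \<exists>b<n. d ! b = (d ! a \<^bold>\<longrightarrow> d ! n)) \<or>
         (\<exists>a<n. d ! n = \<^bold>\<Gamma> (d ! a)) \<or>
         (\<exists>a<n. \<exists>k \<theta> \<phi>. k \<notin> Fv \<phi> \<and> d ! a = (\<theta> \<^bold>\<Rightarrow> \<phi>) \<and> d ! n = (Exi k \<theta> \<^bold>\<Rightarrow> \<phi>))))"

definition derives :: "('i \<Rightarrow> nat) \<Rightarrow> ('m::de_morgan_algebra, 'i) fm set
    \<Rightarrow> ('m, 'i) fm \<Rightarrow> bool" where
  "derives ar \<Sigma> \<phi> \<longleftrightarrow> (\<exists>d. is_derivation ar \<Sigma> d \<and> d \<noteq> [] \<and> last d = \<phi>)"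

definition Q_derives :: "('i \<Rightarrow> nat) \<Rightarrow> 'm set \<Rightarrow> ('m::de_morgan_algebra, 'i) fm set
    \<Rightarrow> ('m, 'i) fm \<Rightarrow> bool" where
  "Q_derives ar Q \<Sigma> \<phi> \<longleftrightarrow> derives ar (relativize Q ` \<Sigma>) (relativize Q \<phi>)"

definition consistent :: "('i \<Rightarrow> nat) \<Rightarrow> ('m::de_morgan_algebra, 'i) fm set \<Rightarrow> bool" where
  "consistent ar \<Sigma> \<longleftrightarrow> \<not> derives ar \<Sigma> (Val 0)"

definition Q_consistent :: "('i \<Rightarrow> nat) \<Rightarrow> 'm set \<Rightarrow> ('m::de_morgan_algebra, 'i) fm set
    \<Rightarrow> bool" where
  "Q_consistent ar Q \<Sigma> \<longleftrightarrow> \<not> Q_derives ar Q \<Sigma> (Val 0)"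

end

theory Submission imports Defs "HOL-Library.Countable_Set" begin

text \<open>
  A consistent set \<open>\<Sigma>\<close> is first treated propositionally. A \<^emph>\<open>point\<close> of \<open>\<Sigma>\<close> is a valuation of the
  prime formulas under which everything derivable from \<open>\<Sigma>\<close> has the value \<open>1\<close>. Since there are
  finitely many truth values, propositional valuations are compact, and a formula is derivable
  exactly if it has the value \<open>1\<close> at all points (\<open>derives_iff_points\<close>); in particular a
  consistent set has a point. From there on no derivations are written down: the axioms and the
  \<open>\<exists>\<close>-rule become statements about values at points.

  A point describes a structure together with one assignment, in which the element assigned to
  \<open>v\<^sub>k\<close> is named by \<open>v\<^sub>k\<close> itself. Reassigning \<open>v\<^sub>k\<close> to the element named by \<open>v\<^sub>l\<close> leads to the
  valuation sending \<open>\<psi>\<close> to the value of \<open>S\<^sup>k\<^sub>l \<psi>\<close>, and this is again a point at which every \<open>\<phi>\<close> has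
  the value that \<open>S\<^sup>k\<^sub>l \<phi>\<close> had (\<open>tval_shift\<close>, \<open>shift_point\<close>). The formulas \<open>\<exists>v\<^sub>k (v\<^sub>k \<approx> v\<^sub>l \<and> \<phi>)\<close> thus
  do the work of syntactic substitution, and bound variables never have to be renamed.

  Fix a finite part \<open>D\<close> of \<open>\<Sigma>\<close> and a number \<open>N\<close> beyond all its variables. Only countably many
  existential formulas matter for \<open>D\<close>, and each can be given its own fresh variable of index
  at least \<open>N\<close> as a witness; compactness yields a point with all these witnesses
  (\<open>henkin_point\<close>). The variables from \<open>N\<close> on are the elements of a structure satisfying \<open>D\<close>, except
  that equality is only a congruence in it (\<open>henkin_truth\<close>).

  The countably many variables of the language cannot witness all existential formulas over an
  uncountable set of relation symbols. The structures for the finite parts are therefore glued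
  by an ultraproduct, which satisfies all of \<open>\<Sigma>\<close> because a finite-valued function has a limit along
  an ultrafilter (\<open>pval_ultraproduct\<close>). The ultraproduct is in general larger than the set of
  formulas; it is cut down to the elements named by Skolem terms (\<open>skolem_hull\<close>), which can be
  coded as formulas, and finally equality is made genuine by choosing representatives
  (\<open>model_of_pval\<close>).

  The version relative to \<open>Q\<close> follows from the first one applied to \<open>\<Sigma>\<^sup>Q\<close>.
\<close>

section \<open>Finite De Morgan algebras\<close>

context de_morgan_algebra begin

lemma mult_self: "x * x = x"
  by (metis mult_absorb add_absorb)

lemma uminus_one: "- 1 = 0"
  by (metis uminus_uminus uminus_mult mult_1_right add_0_left)

lemma uminus_zero: "- 0 = 1"
  by (metis uminus_one uminus_uminus)

lemma zero_mult: "0 * x = 0"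
  by (metis mult_absorb add_0_left)

lemma one_add: "1 + x = 1"
  by (metis add_absorb mult_1_left)

lemma mult_zero: "x * 0 = 0"
  by (metis zero_mult mult.commute)

lemma add_one: "x + 1 = 1"
  by (metis one_add add.commute)

lemma le_one: "x \<le> 1"
  by (simp add: less_eq_iff_mult)

lemma one_le_iff: "1 \<le> x \<longleftrightarrow> x = 1"
  by (auto simp: less_eq_iff_mult)

lemma zero_le: "0 \<le> x"
  by (simp add: less_eq_iff_mult zero_mult)

lemma le_zero_iff: "x \<le> 0 \<longleftrightarrow> x = 0"
  by (metis less_eq_iff_mult mult.commute zero_mult)

lemma le_iff_add: "x \<le> y \<longleftrightarrow> x + y = y"
  by (metis less_eq_iff_mult mult_absorb add_absorb add.commute mult.commute)

lemma le_add1: "x \<le> x + y"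
  by (simp add: less_eq_iff_mult mult_absorb)

lemma le_add2: "y \<le> x + y"
  by (metis add.commute le_add1)

lemma add_le: "x \<le> z \<Longrightarrow> y \<le> z \<Longrightarrow> x + y \<le> z"
  by (simp add: le_iff_add add.assoc)

lemma mult_le1: "x * y \<le> x"
  by (metis le_iff_add add_absorb add.commute)

lemma mult_le2: "x * y \<le> y"
  by (metis mult.commute mult_le1)

lemma le_mult: "z \<le> x \<Longrightarrow> z \<le> y \<Longrightarrow> z \<le> x * y"
  by (simp add: less_eq_iff_mult mult.assoc[symmetric])

lemma uminus_eq_iff: "- x = y \<longleftrightarrow> x = - y"
  by (metis uminus_uminus)

end

lemmas dm_simps = uminus_one uminus_zero zero_mult mult_zero one_add add_one zero_le le_one one_le_iff le_zero_iff uminus_uminus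

text \<open>
  This makes the supremum of all attained values the largest of the suprema over which the
  semantics of \<open>\<exists>\<close> and the axiom for \<open>\<gamma>\<^sub>p \<exists>v\<^sub>k \<phi>\<close> quantify.
\<close>

lemma sum_mono_set:
  fixes A :: "'m::{finite,de_morgan_algebra} set"
  assumes "A \<subseteq> B"
  shows "\<Sum>A \<le> \<Sum>B"
proof -
  have "\<Sum>B = \<Sum>A + \<Sum>(B - A)"
    using assms by (metis finite sum.subset_diff add.commute)
  then show ?thesis by (simp add: le_add1)
qed

section \<open>Ultrafilters\<close>

definition ultra :: "'a filter \<Rightarrow> bool" where
  "ultra G \<longleftrightarrow> G \<noteq> bot \<and> (\<forall>P. eventually P G \<or> eventually (\<lambda>x. \<not> P x) G)"

text \<open>
  Zorn's lemma is applied to the sets of predicates that hold eventually: they are ordered by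
  inclusion as the filters are by refinement, and the union of a chain of them belongs to the
  infimum of the chain of filters.
\<close>

lemma ultra_exists:
  fixes F :: "'a filter"
  assumes "F \<noteq> bot"
  shows "\<exists>G\<le>F. ultra G"
proof -
  define ev :: "'a filter \<Rightarrow> ('a \<Rightarrow> bool) set" where "ev G = {P. eventually P G}" for G
  define \<F> where "\<F> = {G. G \<noteq> bot \<and> G \<le> F}"
  have ev_le: "ev G \<subseteq> ev H \<longleftrightarrow> H \<le> G" for G H
    by (auto simp: ev_def le_filter_def)
  have "\<exists>M\<in>ev ` \<F>. \<forall>X\<in>ev ` \<F>. M \<subseteq> X \<longrightarrow> X = M"
  proof (rule subset_Zorn_nonempty)
    show "ev ` \<F> \<noteq> {}" using assms by (auto simp: \<F>_def)
  next
    fix C assume C: "C \<noteq> {}" "subset.chain (ev ` \<F>) C"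
    define D where "D = {G \<in> \<F>. ev G \<in> C}"
    have CD: "C = ev ` D" using C(2) by (auto simp: D_def subset.chain_def)
    have ne: "D \<noteq> {}" using C(1) CD by auto
    have base: "\<exists>K\<in>D. K \<le> inf G H" if "G \<in> D" "H \<in> D" for G H
    proof -
      have "ev G \<subseteq> ev H \<or> ev H \<subseteq> ev G"
        using that C(2) unfolding D_def subset.chain_def by blast
      then show ?thesis using that by (auto simp: ev_le)
    qed
    have Inf: "eventually P (Inf D) \<longleftrightarrow> (\<exists>G\<in>D. eventually P G)" for P
      using ne base by (rule eventually_Inf_base)
    have "Inf D \<noteq> bot"
      unfolding trivial_limit_def Inf by (auto simp: D_def \<F>_def trivial_limit_def)
    moreover have "Inf D \<le> F"
      using ne by (auto simp: D_def \<F>_def intro: Inf_lower2)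
    ultimately have "Inf D \<in> \<F>" by (simp add: \<F>_def)
    moreover have "\<Union> C = ev (Inf D)"
      unfolding CD by (auto simp: ev_def Inf)
    ultimately show "\<Union> C \<in> ev ` \<F>" by blast
  qed
  then obtain G where G: "G \<in> \<F>" and max: "\<And>H. H \<in> \<F> \<Longrightarrow> H \<le> G \<Longrightarrow> H = G"
    by (auto simp: ev_le) (metis ev_le order.antisym order.refl)
  have "eventually P G \<or> eventually (\<lambda>x. \<not> P x) G" for P
  proof (rule disjCI)
    assume "\<not> eventually (\<lambda>x. \<not> P x) G"
    then have "inf G (principal {x. P x}) \<noteq> bot"
      by (simp add: trivial_limit_def eventually_inf_principal)
    then have "inf G (principal {x. P x}) \<in> \<F>"
      using G by (auto simp: \<F>_def intro: le_infI1)
    then have "inf G (principal {x. P x}) = G"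
      by (rule max) simp
    then show "eventually P G"
      by (metis inf.cobounded2 eventually_principal le_filter_def mem_Collect_eq)
  qed
  then show ?thesis using G by (auto simp: ultra_def \<F>_def)
qed

definition ulim :: "'a filter \<Rightarrow> ('a \<Rightarrow> 'm) \<Rightarrow> 'm" where
  "ulim G f = (SOME m. eventually (\<lambda>x. f x = m) G)"

text \<open>
  Each value is either eventually attained or eventually avoided, and finitely many avoided
  values are avoided simultaneously.
\<close>

lemma eventually_ulim:
  fixes f :: "'a \<Rightarrow> 'm::finite"
  assumes "ultra G"
  shows "eventually (\<lambda>x. f x = ulim G f) G"
proof -
  have "\<exists>m. eventually (\<lambda>x. f x = m) G"
  proof (rule ccontr)
    assume "\<not> ?thesis"
    then have "eventually (\<lambda>x. f x \<noteq> m) G" for m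
      using assms by (auto simp: ultra_def)
    then have "eventually (\<lambda>x. \<forall>m. f x \<noteq> m) G"
      by (rule eventually_all_finite)
    then show False using assms by (simp add: ultra_def)
  qed
  then show ?thesis unfolding ulim_def by (rule someI_ex)
qed

lemma ulim_eqI:
  fixes f :: "'a \<Rightarrow> 'm::finite"
  assumes "ultra G" "eventually (\<lambda>x. f x = m) G"
  shows "ulim G f = m"
proof -
  have "eventually (\<lambda>x. ulim G f = m) G"
    using assms(2) eventually_ulim[OF assms(1), of f] by eventually_elim simp
  then show ?thesis using assms(1) by (simp add: ultra_def eventually_const_iff)
qed

lemma ultra_cases:
  assumes "ultra G"
  obtains "eventually P G" | "eventually (\<lambda>x. \<not> P x) G"
  using assms by (auto simp: ultra_def)

text \<open>
  Compactness of the propositional part. The valuations chosen for the finite subsets have a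
  limit along an ultrafilter, and taking values of formulas commutes with that limit.
\<close>

lemma valuation_compactness:
  fixes \<Gamma> :: "('m::{finite,de_morgan_algebra}, 'i) fm set"
  assumes "\<And>D. finite D \<Longrightarrow> D \<subseteq> \<Gamma> \<Longrightarrow> \<exists>v. \<forall>\<phi>\<in>D. tval \<phi> v = 1"
  shows "\<exists>v. \<forall>\<phi>\<in>\<Gamma>. tval \<phi> v = 1"
proof -
  obtain G where GF: "G \<le> finite_subsets_at_top \<Gamma>" and G: "ultra G"
    using ultra_exists[OF finite_subsets_at_top_neq_bot] by blast
  have ev: "eventually P G" if "eventually P (finite_subsets_at_top \<Gamma>)" for P
    using GF that by (simp add: le_filter_def)
  obtain V where V: "\<And>D. finite D \<Longrightarrow> D \<subseteq> \<Gamma> \<Longrightarrow> \<forall>\<phi>\<in>D. tval \<phi> (V D) = 1"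
    using assms by metis
  define v where "v \<psi> = ulim G (\<lambda>D. V D \<psi>)" for \<psi>
  have v: "eventually (\<lambda>D. V D \<psi> = v \<psi>) G" for \<psi>
    unfolding v_def by (rule eventually_ulim[OF G])
  have lim: "eventually (\<lambda>D. tval \<phi> (V D) = tval \<phi> v) G" for \<phi>
  proof (induction \<phi>)
    case (Neg \<phi>) then show ?case by (auto elim: eventually_mono)
  next
    case (And \<phi> \<theta>)
    then show ?case by eventually_elim simp
  next
    case (Or \<phi> \<theta>)
    then show ?case by eventually_elim simp
  next
    case (Gam p \<phi>) then show ?case by (auto elim: eventually_mono)
  qed (use v in \<open>auto elim: eventually_mono\<close>)
  have "tval \<phi> v = 1" if "\<phi> \<in> \<Gamma>" for \<phi>
  proof -
    have "eventually (\<lambda>D. tval \<phi> (V D) = 1) (finite_subsets_at_top \<Gamma>)"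
      unfolding eventually_finite_subsets_at_top
      using that V by (intro exI[of _ "{\<phi>}"]) auto
    from ev[OF this] lim[of \<phi>] have "eventually (\<lambda>D. tval \<phi> v = 1) G"
      by eventually_elim simp
    then show ?thesis using G by (simp add: ultra_def eventually_const_iff)
  qed
  then show ?thesis by blast
qed

section \<open>Structures in which equality is an equivalence relation\<close>

text \<open>
  The value of a formula under an assignment in a structure whose universe is the whole type
  and in which \<open>\<approx>\<close> is interpreted by a relation \<open>E\<close>. A quantifier takes the supremum of all attained
  values, which exists because the truth values are finitely many; \<open>sem_quotient\<close> relates this
  to the semantics by components.
\<close>

primrec pval :: "('u \<Rightarrow> 'u \<Rightarrow> bool) \<Rightarrow> ('i \<Rightarrow> 'u list \<Rightarrow> 'm) \<Rightarrow>
    ('m::de_morgan_algebra, 'i) fm \<Rightarrow> (nat \<Rightarrow> 'u) \<Rightarrow> 'm" where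
  "pval E I (Rel i ks) s = I i (map s ks)"
| "pval E I (j \<^bold>\<approx> k) s = (if E (s j) (s k) then 1 else 0)"
| "pval E I (Val p) s = p"
| "pval E I (\<^bold>\<not> \<phi>) s = - pval E I \<phi> s"
| "pval E I (\<phi> \<^bold>\<and> \<theta>) s = pval E I \<phi> s * pval E I \<theta> s"
| "pval E I (\<phi> \<^bold>\<or> \<theta>) s = pval E I \<phi> s + pval E I \<theta> s"
| "pval E I (Exi k \<phi>) s = \<Sum>{pval E I \<phi> (s(k := x)) | x. True}"
| "pval E I (Gam p \<phi>) s = (if pval E I \<phi> s = p then 1 else 0)"

definition congruence :: "('i \<Rightarrow> nat) \<Rightarrow> ('u \<Rightarrow> 'u \<Rightarrow> bool) \<Rightarrow> ('i \<Rightarrow> 'u list \<Rightarrow> 'm) \<Rightarrow> bool" where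
  "congruence ar E I \<longleftrightarrow> equivp E \<and>
     (\<forall>i xs ys. length xs = ar i \<longrightarrow> list_all2 E xs ys \<longrightarrow> I i xs = I i ys)"

lemma pval_cong:
  assumes "congruence ar E I"
  shows "is_formula ar \<phi> \<Longrightarrow> (\<And>k. E (s k) (t k)) \<Longrightarrow> pval E I \<phi> s = pval E I \<phi> t"
proof (induction \<phi> arbitrary: s t)
  case (Rel i ks)
  then have "list_all2 E (map s ks) (map t ks)"
    by (simp add: list_all2_conv_all_nth)
  then show ?case using assms Rel by (auto simp: congruence_def)
next
  case (Eq j k)
  have "E (s j) (s k) = E (t j) (t k)"
    using assms Eq unfolding congruence_def by (metis equivp_symp equivp_transp)
  then show ?case by simp
next
  case (Exi k \<phi>)
  have "E ((s(k := x)) l) ((t(k := x)) l)" for x l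
    using assms Exi.prems(2) by (auto simp: congruence_def equivp_reflp)
  then have "pval E I \<phi> (s(k := x)) = pval E I \<phi> (t(k := x))" for x
    using Exi by (intro Exi.IH) auto
  then show ?case by simp
next
  case (And \<phi> \<theta>) then show ?case by (metis pval.simps(5) is_formula.simps(5))
next
  case (Or \<phi> \<theta>) then show ?case by (metis pval.simps(6) is_formula.simps(6))
next
  case (Neg \<phi>) then show ?case by (metis pval.simps(4) is_formula.simps(4))
next
  case (Gam p \<phi>) then show ?case by (metis pval.simps(8) is_formula.simps(8))
qed simp

text \<open>
  The theorem of Los for finitely many truth values. In the quantifier step a value attained
  in the ultraproduct is attained in almost all factors; conversely, if a value is attained in
  almost all factors, then choosing a witness in each of them gives an element of the product
  that attains it. As there are finitely many values, the sets of attained values agree in almost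
  all factors.
\<close>

lemma pval_ultraproduct:
  fixes I :: "'a \<Rightarrow> 'i \<Rightarrow> 'u list \<Rightarrow> 'm::{finite,de_morgan_algebra}"
  assumes G: "ultra G"
    and E': "\<And>f g. E' f g \<longleftrightarrow> eventually (\<lambda>x. E x (f x) (g x)) G"
    and I': "\<And>i fs. I' i fs = ulim G (\<lambda>x. I x i (map (\<lambda>f. f x) fs))"
  shows "eventually (\<lambda>x. pval (E x) (I x) \<phi> (\<lambda>k. s k x) = pval E' I' \<phi> s) G"
proof (induction \<phi> arbitrary: s)
  case (Rel i ks)
  show ?case
    using eventually_ulim[OF G, of "\<lambda>x. I x i (map (\<lambda>f. f x) (map s ks))"]
    by (simp add: I' comp_def)
next
  case (Eq j k)
  show ?case
  proof (rule ultra_cases[OF G, of "\<lambda>x. E x (s j x) (s k x)"])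
    assume "eventually (\<lambda>x. E x (s j x) (s k x)) G"
    then show ?thesis by (auto simp: E' elim: eventually_mono)
  next
    assume *: "eventually (\<lambda>x. \<not> E x (s j x) (s k x)) G"
    have "\<not> E' (s j) (s k)"
    proof
      assume "E' (s j) (s k)"
      then have "eventually (\<lambda>x. E x (s j x) (s k x)) G" by (simp add: E')
      with * have "eventually (\<lambda>x. False) G" by eventually_elim simp
      then show False using G by (simp add: ultra_def)
    qed
    with * show ?thesis by (auto elim: eventually_mono)
  qed
next
  case (Val p) show ?case by simp
next
  case (Neg \<phi>)
  from Neg.IH[of s] show ?case by eventually_elim simp
next
  case (And \<phi> \<theta>)
  from And.IH(1)[of s] And.IH(2)[of s] show ?case by eventually_elim simp
next
  case (Or \<phi> \<theta>)
  from Or.IH(1)[of s] Or.IH(2)[of s] show ?case by eventually_elim simp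
next
  case (Gam p \<phi>)
  from Gam.IH[of s] show ?case by eventually_elim simp
next
  case (Exi k \<phi>)
  define W where "W x = {pval (E x) (I x) \<phi> ((\<lambda>j. s j x)(k := y)) | y. True}" for x
  define W' where "W' = {pval E' I' \<phi> (s(k := f)) | f. True}"
  have upd: "(\<lambda>j. (s(k := f)) j x) = (\<lambda>j. s j x)(k := f x)" for f x
    by auto
  have IH: "eventually (\<lambda>x. pval (E x) (I x) \<phi> ((\<lambda>j. s j x)(k := f x)) =
      pval E' I' \<phi> (s(k := f))) G" for f
    using Exi.IH[of "s(k := f)"] by (simp only: upd)
  have "eventually (\<lambda>x. q \<in> W x \<longleftrightarrow> q \<in> W') G" for q
  proof (cases "q \<in> W'")
    case True
    then obtain f where f: "q = pval E' I' \<phi> (s(k := f))" by (auto simp: W'_def)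
    show ?thesis
      using IH[of f]
    proof eventually_elim
      case (elim x)
      then have "q = pval (E x) (I x) \<phi> ((\<lambda>j. s j x)(k := f x))" by (simp only: f)
      then have "q \<in> W x" unfolding W_def by blast
      with True show ?case by simp
    qed
  next
    case False
    define f where "f x = (SOME y. pval (E x) (I x) \<phi> ((\<lambda>j. s j x)(k := y)) = q)" for x
    have f: "pval (E x) (I x) \<phi> ((\<lambda>j. s j x)(k := f x)) = q" if "q \<in> W x" for x
      unfolding f_def by (rule someI_ex) (use that in \<open>unfold W_def, blast\<close>)
    have ne: "pval E' I' \<phi> (s(k := f)) \<noteq> q" using False by (auto simp: W'_def)
    show ?thesis
      using IH[of f]
    proof eventually_elim
      case (elim x)
      then show ?case using False ne f[of x] by metis
    qed
  qed
  then have "eventually (\<lambda>x. \<forall>q. q \<in> W x \<longleftrightarrow> q \<in> W') G"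
    by (rule eventually_all_finite)
  then show ?case
  proof eventually_elim
    case (elim x)
    then have "W x = W'" by blast
    then show ?case by (simp add: W_def W'_def)
  qed
qed

lemma congruence_ultraproduct:
  fixes I :: "'a \<Rightarrow> 'i \<Rightarrow> 'u list \<Rightarrow> 'm::finite"
  assumes G: "ultra G" and cong: "\<And>x. congruence ar (E x) (I x)"
    and E': "\<And>f g. E' f g \<longleftrightarrow> eventually (\<lambda>x. E x (f x) (g x)) G"
    and I': "\<And>i fs. I' i fs = ulim G (\<lambda>x. I x i (map (\<lambda>f. f x) fs))"
  shows "congruence ar E' I'"
  unfolding congruence_def
proof (intro conjI allI impI)
  have eq: "equivp (E x)" for x using cong by (simp add: congruence_def)
  show "equivp E'"
  proof (rule equivpI)
    show "reflp E'" by (rule reflpI) (simp add: E' equivp_reflp[OF eq])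
    show "symp E'" by (rule sympI) (auto simp: E' elim!: eventually_mono intro: equivp_symp[OF eq])
    show "transp E'"
    proof (rule transpI)
      fix f g h assume "E' f g" "E' g h"
      then have "eventually (\<lambda>x. E x (f x) (g x)) G" "eventually (\<lambda>x. E x (g x) (h x)) G"
        by (simp_all add: E')
      then show "E' f h" unfolding E' by eventually_elim (rule equivp_transp[OF eq])
    qed
  qed
  fix i fs gs assume len: "length fs = ar i" and all: "list_all2 E' fs gs"
  have "\<forall>m\<in>{..<ar i}. eventually (\<lambda>x. E x ((fs ! m) x) ((gs ! m) x)) G"
    using all len by (auto simp: list_all2_conv_all_nth E')
  then have "eventually (\<lambda>x. \<forall>m\<in>{..<ar i}. E x ((fs ! m) x) ((gs ! m) x)) G"
    by (intro eventually_ball_finite) auto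
  then have same: "eventually (\<lambda>x. I x i (map (\<lambda>f. f x) fs) = I x i (map (\<lambda>f. f x) gs)) G"
  proof eventually_elim
    case (elim x)
    then have "list_all2 (E x) (map (\<lambda>f. f x) fs) (map (\<lambda>f. f x) gs)"
      using all len by (auto simp: list_all2_conv_all_nth)
    then show ?case using cong[of x] len by (simp add: congruence_def)
  qed
  show "I' i fs = I' i gs"
    unfolding I'
  proof (rule ulim_eqI[OF G])
    show "eventually (\<lambda>x. I x i (map (\<lambda>f. f x) fs) = ulim G (\<lambda>x. I x i (map (\<lambda>f. f x) gs))) G"
      using same eventually_ulim[OF G, of "\<lambda>x. I x i (map (\<lambda>f. f x) gs)"] by eventually_elim simp
  qed
qed

lemma finite_Fv: "finite (Fv \<phi>)"
  by (induction \<phi>) auto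

lemma pval_Fv:
  "(\<And>j. j \<in> Fv \<phi> \<Longrightarrow> s j = t j) \<Longrightarrow> pval E I \<phi> s = pval E I \<phi> t"
proof (induction \<phi> arbitrary: s t)
  case (Rel i ks)
  then have "map s ks = map t ks" by simp
  then show ?case by (metis pval.simps(1))
next
  case (Exi k \<phi>)
  have "pval E I \<phi> (s(k := x)) = pval E I \<phi> (t(k := x))" for x
    using Exi.prems by (intro Exi.IH) auto
  then show ?case by simp
next
  case (And \<phi> \<theta>)
  have "pval E I \<phi> s = pval E I \<phi> t" "pval E I \<theta> s = pval E I \<theta> t"
    using And.prems by (auto intro!: And.IH)
  then show ?case by simp
next
  case (Or \<phi> \<theta>)
  have "pval E I \<phi> s = pval E I \<phi> t" "pval E I \<theta> s = pval E I \<theta> t"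
    using Or.prems by (auto intro!: Or.IH)
  then show ?case by simp
next
  case (Neg \<phi>)
  then show ?case by (metis Fv.simps(4) pval.simps(4))
next
  case (Gam p \<phi>)
  then show ?case by (metis Fv.simps(8) pval.simps(8))
qed auto

text \<open>
  The term with arguments \<open>\<phi>\<close>, \<open>k\<close>, \<open>q\<close> and \<open>ts\<close> names an element, if there is one, that gives \<open>\<phi>\<close> the value \<open>q\<close> when it
  is assigned to \<open>v\<^sub>k\<close> while the other variables are assigned the elements named by \<open>ts\<close>.
  These are the nested applications of Skolem functions, so that they name a set closed under
  witnesses which is no larger than the set of formulas.
\<close>

datatype ('m, 'i) skolem = Skolem "('m, 'i) fm" nat 'm "('m, 'i) skolem list"

text \<open>
  A term is coded by listing its components in a conjunction; the equation at the end marks the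
  end of the list of arguments, since it is not a conjunction.
\<close>

primrec skolem_code :: "('m, 'i) skolem \<Rightarrow> ('m, 'i) fm" where
  "skolem_code (Skolem \<phi> k q ts) =
     \<phi> \<^bold>\<and> (k \<^bold>\<approx> k) \<^bold>\<and> Val q \<^bold>\<and> foldr And (map skolem_code ts) (0 \<^bold>\<approx> 0)"

lemma inj_skolem_code: "inj skolem_code"
proof (rule injI)
  show "skolem_code x = skolem_code y \<Longrightarrow> x = y" for x y :: "('m, 'i) skolem"
  proof (induction x arbitrary: y)
    case (Skolem \<phi> k q ts)
    obtain \<phi>' k' q' us where y: "y = Skolem \<phi>' k' q' us" by (cases y)
    have "\<forall>t\<in>set ts. \<forall>u. skolem_code t = skolem_code u \<longrightarrow> t = u" using Skolem.IH by blast
    then have "foldr And (map skolem_code ts) (0 \<^bold>\<approx> 0) = foldr And (map skolem_code us) (0 \<^bold>\<approx> 0) \<Longrightarrow> ts = us"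
    proof (induction ts arbitrary: us)
      case Nil
      then show ?case by (cases us) auto
    next
      case (Cons t ts)
      then show ?case by (cases us) auto
    qed
    then show ?case using Skolem.prems y by simp
  qed
qed

primrec skolem_eval :: "(('m, 'i) fm \<Rightarrow> nat \<Rightarrow> 'm \<Rightarrow> 'u list \<Rightarrow> 'u) \<Rightarrow> ('m, 'i) skolem \<Rightarrow> 'u" where
  "skolem_eval wit (Skolem \<phi> k q ts) = wit \<phi> k q (map (skolem_eval wit) ts)"

text \<open>
  The downward Loewenheim-Skolem theorem in the form needed here. The values of the terms form a
  substructure in which every quantifier attains the same values as in the given structure, and
  nothing changes if the terms themselves are taken as elements.
\<close>

lemma skolem_hull:
  fixes I :: "'i \<Rightarrow> 'u list \<Rightarrow> 'm::{finite,de_morgan_algebra}"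
  assumes cong: "congruence ar E I"
  shows "\<exists>E' (I' :: 'i \<Rightarrow> ('m, 'i) skolem list \<Rightarrow> 'm). congruence ar E' I' \<and>
    (\<forall>\<phi> t. \<exists>s. pval E' I' \<phi> t = pval E I \<phi> s)"
proof -
  define assign where "assign xs j = (if j < length xs then xs ! j else undefined)" for xs :: "'u list" and j
  define wit where "wit \<phi> k q xs = (SOME a. pval E I \<phi> ((assign xs)(k := a)) = q)" for \<phi> k q xs
  define ev where "ev = skolem_eval wit"
  define E' where "E' a b \<longleftrightarrow> E (ev a) (ev b)" for a b
  define I' where "I' i ts = I i (map ev ts)" for i ts
  have "equivp E" using cong by (simp add: congruence_def)
  then have "equivp E'"
    unfolding E'_def equivp_def by metis
  then have "congruence ar E' I'"
    using cong unfolding congruence_def I'_def E'_def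
    by (auto simp: list_all2_conv_all_nth)
  moreover have "pval E' I' \<phi> t = pval E I \<phi> (\<lambda>j. ev (t j))" for \<phi> t
  proof (induction \<phi> arbitrary: t)
    case (Rel i ks)
    then show ?case by (simp add: I'_def comp_def)
  next
    case (Eq j k)
    then show ?case by (simp add: E'_def)
  next
    case (Exi k \<phi>)
    let ?s = "\<lambda>j. ev (t j)"
    have upd: "(\<lambda>j. ev ((t(k := x)) j)) = ?s(k := ev x)" for x by auto
    have IH: "pval E' I' \<phi> (t(k := x)) = pval E I \<phi> (?s(k := ev x))" for x
      unfolding Exi.IH upd ..
    have "{pval E I \<phi> (?s(k := ev x)) | x. True} = {pval E I \<phi> (?s(k := a)) | a. True}"
    proof (intro equalityI subsetI)
      fix q assume "q \<in> {pval E I \<phi> (?s(k := a)) | a. True}"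
      then obtain a where a: "pval E I \<phi> (?s(k := a)) = q" by blast
      obtain B where B: "\<forall>j\<in>Fv \<phi>. j < B"
        using finite_Fv[of \<phi>] finite_nat_set_iff_bounded by auto
      define x where "x = Skolem \<phi> k q (map t [0..<B])"
      have same: "pval E I \<phi> ((assign (map ?s [0..<B]))(k := b)) = pval E I \<phi> (?s(k := b))" for b
        by (rule pval_Fv) (use B in \<open>auto simp: assign_def\<close>)
      have "pval E I \<phi> ((assign (map ?s [0..<B]))(k := wit \<phi> k q (map ?s [0..<B]))) = q"
        unfolding wit_def by (rule someI[of _ a]) (simp only: same a)
      moreover have "ev x = wit \<phi> k q (map ?s [0..<B])"
        by (simp add: x_def ev_def comp_def)
      ultimately have "pval E I \<phi> (?s(k := ev x)) = q" by (simp add: same)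
      then show "q \<in> {pval E I \<phi> (?s(k := ev x)) | x. True}" by blast
    qed blast
    then show ?case by (simp add: IH)
  qed simp_all
  ultimately show ?thesis by blast
qed

text \<open>
  A set of representatives \<open>U\<close>, named through \<open>rep\<close>, turns the congruence into equality. Among the
  sets of attained values that the semantics of \<open>\<exists>\<close> considers, the set \<open>V\<close> of all attained values
  has the largest supremum; so the component of \<open>\<exists>v\<^sub>k \<phi>\<close> to which an assignment belongs is \<open>\<Sum>V\<close>.
\<close>

lemma sem_quotient:
  fixes rep :: "'u \<Rightarrow> 'w" and dec :: "'w \<Rightarrow> 'u"
    and I :: "'i \<Rightarrow> 'u list \<Rightarrow> 'm::{finite,de_morgan_algebra}"
  assumes cong: "congruence ar E I"
    and rep: "\<And>a b. rep a = rep b \<longleftrightarrow> E a b"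
    and dec: "\<And>a. E (dec (rep a)) a"
    and U: "U = range rep"
    and P: "\<And>i q. P i q = {xs. length xs = ar i \<and> set xs \<subseteq> U \<and> I i (map dec xs) = q}"
  shows "is_formula ar \<phi> \<Longrightarrow> sem U P \<phi> q = {s \<in> seqs U. pval E I \<phi> (\<lambda>j. dec (s j)) = q}"
proof (induction \<phi> arbitrary: q)
  case (Rel i ks)
  then show ?case by (auto simp: P seqs_def comp_def)
next
  case (Eq j k)
  have E: "E (dec x) (dec y) \<longleftrightarrow> x = y" if "x \<in> U" "y \<in> U" for x y
  proof -
    obtain a b where ab: "x = rep a" "y = rep b" using \<open>x \<in> U\<close> \<open>y \<in> U\<close> unfolding U by blast
    have "E (dec x) (dec y) \<longleftrightarrow> E a b"
      using dec[of a] dec[of b] cong ab unfolding congruence_def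
      by (metis equivp_symp equivp_transp)
    then show ?thesis using ab rep by simp
  qed
  have "E (dec (s j)) (dec (s k)) \<longleftrightarrow> s j = s k" if "s \<in> seqs U" for s
    using that E by (auto simp: seqs_def)
  then show ?case by auto
next
  case (Exi k \<phi>)
  define V where "V s = {pval E I \<phi> ((\<lambda>j. dec (s j))(k := a)) | a. True}" for s :: "nat \<Rightarrow> 'w"
  have IH: "sem U P \<phi> q = {s \<in> seqs U. pval E I \<phi> (\<lambda>j. dec (s j)) = q}" for q
    using Exi by auto
  have cyl: "s \<in> cyl U k (sem U P \<phi> q) \<longleftrightarrow> q \<in> V s" if s: "s \<in> seqs U" for s q
  proof -
    have upd: "pval E I \<phi> (\<lambda>j. dec ((s(k := rep a)) j)) = pval E I \<phi> ((\<lambda>j. dec (s j))(k := a))" for a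
      using Exi.prems dec cong
      by (intro pval_cong[OF cong]) (auto simp: congruence_def equivp_reflp)
    have "s(k := rep a) \<in> seqs U" for a
      using s by (simp add: seqs_def U)
    then have "s(k := rep a) \<in> sem U P \<phi> q \<longleftrightarrow> pval E I \<phi> ((\<lambda>j. dec (s j))(k := a)) = q" for a
      unfolding IH using upd[of a] by simp
    moreover have "s \<in> cyl U k (sem U P \<phi> q) \<longleftrightarrow> (\<exists>a. s(k := rep a) \<in> sem U P \<phi> q)"
      using s by (simp add: cyl_def U)
    ultimately show ?thesis by (auto simp: V_def)
  qed
  have sub: "s \<in> (\<Inter>q\<in>A. cyl U k (sem U P \<phi> q)) \<longleftrightarrow> s \<in> seqs U \<and> A \<subseteq> V s"
    if "A \<noteq> {}" for s A
  proof -
    have "s \<in> (\<Inter>q\<in>A. cyl U k (sem U P \<phi> q)) \<Longrightarrow> s \<in> seqs U"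
      using that by (auto simp: cyl_def)
    then show ?thesis using cyl[of s] by blast
  qed
  have union: "s \<in> (\<Union>A\<in>{A. A \<noteq> {} \<and> R A}. \<Inter>q\<in>A. cyl U k (sem U P \<phi> q)) \<longleftrightarrow>
      s \<in> seqs U \<and> (\<exists>A. A \<noteq> {} \<and> R A \<and> A \<subseteq> V s)" for s R
  proof
    assume "s \<in> (\<Union>A\<in>{A. A \<noteq> {} \<and> R A}. \<Inter>q\<in>A. cyl U k (sem U P \<phi> q))"
    then obtain A where A: "A \<noteq> {} \<and> R A" "s \<in> (\<Inter>q\<in>A. cyl U k (sem U P \<phi> q))"
      by (elim UN_E CollectE)
    with sub[of A s] show "s \<in> seqs U \<and> (\<exists>A. A \<noteq> {} \<and> R A \<and> A \<subseteq> V s)" by metis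
  next
    assume "s \<in> seqs U \<and> (\<exists>A. A \<noteq> {} \<and> R A \<and> A \<subseteq> V s)"
    then obtain A where A: "s \<in> seqs U" "A \<noteq> {}" "R A" "A \<subseteq> V s" by metis
    then have "s \<in> (\<Inter>q\<in>A. cyl U k (sem U P \<phi> q))" using sub[of A s] by metis
    then show "s \<in> (\<Union>A\<in>{A. A \<noteq> {} \<and> R A}. \<Inter>q\<in>A. cyl U k (sem U P \<phi> q))"
      using A by (intro UN_I[of A]) simp_all
  qed
  have V: "V s \<noteq> {}" for s by (auto simp: V_def)
  have main: "s \<in> sem U P (Exi k \<phi>) q \<longleftrightarrow> s \<in> seqs U \<and> \<Sum>(V s) = q" for s
  proof -
    have "s \<in> sem U P (Exi k \<phi>) q \<longleftrightarrow> s \<in> seqs U \<and>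
      (\<exists>A. A \<noteq> {} \<and> \<Sum>A = q \<and> A \<subseteq> V s) \<and> \<not> (\<exists>A. A \<noteq> {} \<and> \<Sum>A > q \<and> A \<subseteq> V s)"
      unfolding sem.simps Diff_iff union by metis
    also have "\<dots> \<longleftrightarrow> s \<in> seqs U \<and> \<Sum>(V s) = q"
    proof -
      have "(\<exists>A. A \<noteq> {} \<and> \<Sum>A = q \<and> A \<subseteq> V s) \<and> \<not> (\<exists>A. A \<noteq> {} \<and> \<Sum>A > q \<and> A \<subseteq> V s)
        \<longleftrightarrow> \<Sum>(V s) = q" (is "?L \<longleftrightarrow> ?R")
      proof
        assume ?L
        then obtain A where A: "\<Sum>A = q" "A \<subseteq> V s" and "\<not> \<Sum>(V s) > q"
          using V by blast
        then show ?R using sum_mono_set[OF A(2)] by (simp add: order_less_le)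
      next
        assume ?R
        moreover have "\<not> \<Sum>A > q" if "A \<subseteq> V s" for A
          using sum_mono_set[OF that] \<open>?R\<close> by (simp add: leD)
        ultimately show ?L using V by blast
      qed
      then show ?thesis by blast
    qed
    finally show ?thesis .
  qed
  have "pval E I (Exi k \<phi>) (\<lambda>j. dec (s j)) = \<Sum>(V s)" for s
    by (simp add: V_def)
  then show ?case unfolding set_eq_iff mem_Collect_eq main by simp
next
  case (And \<phi> \<theta>)
  then show ?case by auto
next
  case (Or \<phi> \<theta>)
  then show ?case by auto
next
  case (Neg \<phi>)
  then show ?case by (auto simp: uminus_eq_iff)
next
  case (Gam p \<phi>)
  then show ?case by auto
qed (auto)

text \<open>
  The universe consists of the codes of one representative from each class of \<open>E\<close>.
\<close>

lemma model_of_pval: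
  fixes code :: "'u \<Rightarrow> 'w" and I :: "'i \<Rightarrow> 'u list \<Rightarrow> 'm::{finite,de_morgan_algebra}"
  assumes cong: "congruence ar E I" and code: "inj code"
    and \<Sigma>: "\<And>\<phi>. \<phi> \<in> \<Sigma> \<Longrightarrow> is_formula ar \<phi>"
    and true: "\<And>\<phi> s. \<phi> \<in> \<Sigma> \<Longrightarrow> pval E I \<phi> s = 1"
  shows "\<exists>(U :: 'w set) P. is_model ar U P \<Sigma>"
proof -
  have eq: "equivp E" using cong by (simp add: congruence_def)
  define dec where "dec = inv code"
  define rep where "rep a = code (SOME b. E a b)" for a
  define U where "U = range rep"
  define P where "P i q = {xs. length xs = ar i \<and> set xs \<subseteq> U \<and> I i (map dec xs) = q}" for i q
  have E: "E a (SOME b. E a b)" for a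
    using eq by (metis equivp_reflp someI)
  have rep: "rep a = rep b \<longleftrightarrow> E a b" for a b
  proof
    assume "E a b"
    then have "E a = E b" using eq by (simp add: equivp_def)
    then show "rep a = rep b" by (simp add: rep_def)
  next
    assume "rep a = rep b"
    then have "(SOME c. E a c) = (SOME c. E b c)"
      using code by (auto simp: rep_def dest: injD)
    then show "E a b" using E[of a] E[of b] eq by (metis equivp_symp equivp_transp)
  qed
  have dec: "E (dec (rep a)) a" for a
    unfolding dec_def rep_def inv_f_f[OF code] using E[of a] eq by (metis equivp_symp)
  have "is_structure ar U P"
    unfolding is_structure_def P_def by (auto simp: U_def)
  moreover have "true_in U P \<phi>" if "\<phi> \<in> \<Sigma>" for \<phi>
    unfolding true_in_def
    using sem_quotient[OF cong rep dec U_def P_def \<Sigma>[OF that]] true[OF that] by simp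
  ultimately show ?thesis unfolding is_model_def by blast
qed

section \<open>Values of the abbreviations\<close>

lemma listing_set:
  assumes "finite A"
  shows "distinct (listing A)" "set (listing A) = A"
  using someI_ex[of "\<lambda>xs. distinct xs \<and> set xs = A"] finite_distinct_list[OF assms]
  by (auto simp: listing_def)

lemma Fv_and_list: "Fv (and_list xs) = (\<Union>\<phi>\<in>set xs. Fv \<phi>)"
  by (induction xs rule: and_list.induct) auto

lemma Fv_or_list: "Fv (or_list xs) = (\<Union>\<phi>\<in>set xs. Fv \<phi>)"
  by (induction xs rule: or_list.induct) auto

lemma formula_and_list: "is_formula ar (and_list xs) \<longleftrightarrow> (\<forall>\<phi>\<in>set xs. is_formula ar \<phi>)"
  by (induction xs rule: and_list.induct) auto

lemma formula_or_list: "is_formula ar (or_list xs) \<longleftrightarrow> (\<forall>\<phi>\<in>set xs. is_formula ar \<phi>)"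
  by (induction xs rule: or_list.induct) auto

lemma tval_and_list:
  "\<forall>\<phi>\<in>set xs. tval \<phi> v \<in> {0, 1} \<Longrightarrow>
   tval (and_list xs) v = (if \<forall>\<phi>\<in>set xs. tval \<phi> v = 1 then 1 else 0)"
  by (induction xs rule: and_list.induct) (auto simp: dm_simps)

lemma tval_or_list:
  "\<forall>\<phi>\<in>set xs. tval \<phi> v \<in> {0, 1} \<Longrightarrow>
   tval (or_list xs) v = (if \<exists>\<phi>\<in>set xs. tval \<phi> v = 1 then 1 else 0)"
  by (induction xs rule: or_list.induct) (auto simp: dm_simps)

lemma Fv_BigOr: "finite A \<Longrightarrow> Fv (BigOr A f) = (\<Union>a\<in>A. Fv (f a))"
  by (simp add: BigOr_def Fv_or_list listing_set)

lemma formula_BigOr: "finite A \<Longrightarrow> is_formula ar (BigOr A f) \<longleftrightarrow> (\<forall>a\<in>A. is_formula ar (f a))"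
  by (simp add: BigOr_def formula_or_list listing_set)

lemma formula_BigAnd: "finite A \<Longrightarrow> is_formula ar (BigAnd A f) \<longleftrightarrow> (\<forall>a\<in>A. is_formula ar (f a))"
  by (simp add: BigAnd_def formula_and_list listing_set)

lemma tval_BigOr:
  assumes "finite A" "\<And>a. a \<in> A \<Longrightarrow> tval (f a) v \<in> {0, 1}"
  shows "tval (BigOr A f) v = (if \<exists>a\<in>A. tval (f a) v = 1 then 1 else 0)"
  using assms unfolding BigOr_def by (subst tval_or_list) (auto simp: listing_set)

lemma tval_BigAnd:
  assumes "finite A" "\<And>a. a \<in> A \<Longrightarrow> tval (f a) v \<in> {0, 1}"
  shows "tval (BigAnd A f) v = (if \<forall>a\<in>A. tval (f a) v = 1 then 1 else 0)"
  using assms unfolding BigAnd_def by (subst tval_and_list) (auto simp: listing_set)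

lemma formula_Imp [simp]: "is_formula ar (\<theta> \<^bold>\<longrightarrow> \<phi>) \<longleftrightarrow> is_formula ar \<theta> \<and> is_formula ar \<phi>"
  by (simp add: Imp_def)

lemma tval_Imp [simp]: "tval (\<theta> \<^bold>\<longrightarrow> \<phi>) v = - tval \<theta> v + tval \<phi> v"
  by (simp add: Imp_def)

lemma formula_Below [simp]:
  fixes \<theta> \<phi> :: "('m::{finite,de_morgan_algebra}, 'i) fm"
  shows "is_formula ar (\<theta> \<^bold>\<Rightarrow> \<phi>) \<longleftrightarrow> is_formula ar \<theta> \<and> is_formula ar \<phi>"
  by (auto simp: Below_def formula_BigAnd formula_BigOr)

lemma tval_Below [simp]:
  fixes \<theta> \<phi> :: "('m::{finite,de_morgan_algebra}, 'i) fm"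
  shows "tval (\<theta> \<^bold>\<Rightarrow> \<phi>) v = (if tval \<theta> v \<le> tval \<phi> v then 1 else 0)"
proof -
  have "tval (BigOr {q. q \<le> r} (\<lambda>q. Gam q \<theta>)) v = (if tval \<theta> v \<le> r then 1 else 0)" for r
    by (subst tval_BigOr) auto
  then have "tval (Gam r \<phi> \<^bold>\<longrightarrow> BigOr {q. q \<le> r} (\<lambda>q. Gam q \<theta>)) v =
      (if tval \<phi> v = r \<longrightarrow> tval \<theta> v \<le> r then 1 else 0)" for r
    by (auto simp: dm_simps)
  then show ?thesis
    unfolding Below_def by (subst tval_BigAnd) auto
qed

lemma formula_Same [simp]:
  fixes \<theta> \<phi> :: "('m::{finite,de_morgan_algebra}, 'i) fm"
  shows "is_formula ar (\<theta> \<^bold>\<Leftrightarrow> \<phi>) \<longleftrightarrow> is_formula ar \<theta> \<and> is_formula ar \<phi>"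
  by (auto simp: Same_def)

lemma tval_Same [simp]:
  fixes \<theta> \<phi> :: "('m::{finite,de_morgan_algebra}, 'i) fm"
  shows "tval (\<theta> \<^bold>\<Leftrightarrow> \<phi>) v = (if tval \<theta> v = tval \<phi> v then 1 else 0)"
  by (auto simp: Same_def dm_simps dest: order.antisym)

lemma formula_Crisp [simp]: "is_formula ar (\<^bold>\<Gamma> \<phi>) \<longleftrightarrow> is_formula ar \<phi>"
  by (simp add: Crisp_def)

lemma tval_Crisp [simp]: "tval (\<^bold>\<Gamma> \<phi>) v = (if tval \<phi> v \<in> {0, 1} then 1 else 0)"
  by (auto simp: Crisp_def dm_simps)

lemma formula_Subst [simp]: "is_formula ar (Subst k l \<phi>) \<longleftrightarrow> is_formula ar \<phi>"
  by (simp add: Subst_def)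

lemma Fv_Subst [simp]: "Fv (Subst k l \<phi>) = insert l (Fv \<phi>) - {k}"
  by (auto simp: Subst_def)

section \<open>Derivations\<close>

text \<open>
  One step of a derivation, with \<open>\<Pi>\<close> the set of earlier members.
\<close>

definition follows :: "('i \<Rightarrow> nat) \<Rightarrow> ('m::de_morgan_algebra, 'i) fm set \<Rightarrow> ('m, 'i) fm set
    \<Rightarrow> ('m, 'i) fm \<Rightarrow> bool" where
  "follows ar \<Sigma> \<Pi> \<phi> \<longleftrightarrow> is_formula ar \<phi> \<and>
     (\<phi> \<in> \<Sigma> \<or> is_axiom ar \<phi> \<or> (\<exists>\<psi>\<in>\<Pi>. \<psi> \<^bold>\<longrightarrow> \<phi> \<in> \<Pi>) \<or> (\<exists>\<psi>\<in>\<Pi>. \<phi> = \<^bold>\<Gamma> \<psi>) \<or>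
      (\<exists>\<psi>\<in>\<Pi>. \<exists>k \<theta> \<chi>. k \<notin> Fv \<chi> \<and> \<psi> = (\<theta> \<^bold>\<Rightarrow> \<chi>) \<and> \<phi> = (Exi k \<theta> \<^bold>\<Rightarrow> \<chi>)))"

lemma follows_mono: "follows ar \<Sigma> \<Pi> \<phi> \<Longrightarrow> \<Pi> \<subseteq> \<Pi>' \<Longrightarrow> follows ar \<Sigma> \<Pi>' \<phi>"
  unfolding follows_def by blast

lemma is_derivation_iff:
  "is_derivation ar \<Sigma> d \<longleftrightarrow> (\<forall>n<length d. follows ar \<Sigma> ((!) d ` {..<n}) (d ! n))"
proof -
  have "(\<exists>a<n. \<exists>b<n. d ! b = \<chi> a) \<longleftrightarrow> (\<exists>a<n. \<chi> a \<in> (!) d ` {..<n})" for n \<chi>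
    unfolding image_iff by (metis lessThan_iff)
  then show ?thesis
    unfolding is_derivation_def follows_def by (simp add: Bex_def)
qed

lemma is_derivation_append:
  assumes d: "is_derivation ar \<Sigma> d" and e: "is_derivation ar \<Sigma> e"
  shows "is_derivation ar \<Sigma> (d @ e)"
  unfolding is_derivation_iff
proof (intro allI impI)
  fix n assume n: "n < length (d @ e)"
  show "follows ar \<Sigma> ((!) (d @ e) ` {..<n}) ((d @ e) ! n)"
  proof (cases "n < length d")
    case True
    then have "(!) (d @ e) ` {..<n} = (!) d ` {..<n}"
      by (intro image_cong) (auto simp: nth_append)
    then show ?thesis using d True by (simp add: is_derivation_iff nth_append)
  next
    case False
    define m where "m = n - length d"
    have m: "m < length e" "n = length d + m" using False n by (auto simp: m_def)
    have "(!) e ` {..<m} \<subseteq> (!) (d @ e) ` {..<n}"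
    proof
      fix \<psi> assume "\<psi> \<in> (!) e ` {..<m}"
      then obtain a where "a < m" "\<psi> = e ! a" by auto
      then show "\<psi> \<in> (!) (d @ e) ` {..<n}"
        by (intro image_eqI[of _ _ "length d + a"]) (auto simp: m)
    qed
    moreover have "follows ar \<Sigma> ((!) e ` {..<m}) (e ! m)"
      using e m(1) by (simp add: is_derivation_iff)
    ultimately show ?thesis using follows_mono by (simp add: m(2))
  qed
qed

lemma derives_step:
  assumes "set ps \<subseteq> {\<psi>. derives ar \<Sigma> \<psi>}" and "follows ar \<Sigma> (set ps) \<phi>"
  shows "derives ar \<Sigma> \<phi>"
proof -
  have "\<exists>d. is_derivation ar \<Sigma> d \<and> set ps \<subseteq> set d"
    using assms(1)
  proof (induction ps)
    case Nil
    then show ?case by (intro exI[of _ "[]"]) (simp add: is_derivation_def)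
  next
    case (Cons \<psi> ps)
    then obtain d where d: "is_derivation ar \<Sigma> d" "set ps \<subseteq> set d" by auto
    from Cons.prems obtain e where e: "is_derivation ar \<Sigma> e" "e \<noteq> []" "last e = \<psi>"
      by (auto simp: derives_def)
    then have "\<psi> \<in> set e" using last_in_set by blast
    with d is_derivation_append[OF d(1) e(1)] show ?case by (intro exI[of _ "d @ e"]) auto
  qed
  then obtain d where d: "is_derivation ar \<Sigma> d" "set ps \<subseteq> set d" by blast
  have "is_derivation ar \<Sigma> (d @ [\<phi>])"
    unfolding is_derivation_iff
  proof (intro allI impI)
    fix n assume "n < length (d @ [\<phi>])"
    then consider "n < length d" | "n = length d" by fastforce
    then show "follows ar \<Sigma> ((!) (d @ [\<phi>]) ` {..<n}) ((d @ [\<phi>]) ! n)"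
    proof cases
      case 1
      then have "(!) (d @ [\<phi>]) ` {..<n} = (!) d ` {..<n}"
        by (intro image_cong) (auto simp: nth_append)
      then show ?thesis using d(1) 1 by (simp add: is_derivation_iff nth_append)
    next
      case 2
      have "set d = (!) (d @ [\<phi>]) ` {..<n}"
        unfolding 2 by (force simp: set_conv_nth nth_append)
      then show ?thesis using follows_mono[OF assms(2) d(2)] by (simp add: 2)
    qed
  qed
  then show ?thesis unfolding derives_def by (intro exI[of _ "d @ [\<phi>]"]) simp
qed

lemma derives_formula: "derives ar \<Sigma> \<phi> \<Longrightarrow> is_formula ar \<phi>"
  unfolding derives_def is_derivation_def
  by (metis last_conv_nth length_greater_0_conv diff_less zero_less_one)

lemma derives_hyp: "\<phi> \<in> \<Sigma> \<Longrightarrow> is_formula ar \<phi> \<Longrightarrow> derives ar \<Sigma> \<phi>"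
  by (rule derives_step[of "[]"]) (auto simp: follows_def)

lemma derives_axiom: "is_axiom ar \<phi> \<Longrightarrow> is_formula ar \<phi> \<Longrightarrow> derives ar \<Sigma> \<phi>"
  by (rule derives_step[of "[]"]) (auto simp: follows_def)

lemma derives_mp: "derives ar \<Sigma> \<phi> \<Longrightarrow> derives ar \<Sigma> (\<phi> \<^bold>\<longrightarrow> \<theta>) \<Longrightarrow> derives ar \<Sigma> \<theta>"
  by (rule derives_step[of "[\<phi>, \<phi> \<^bold>\<longrightarrow> \<theta>]"]) (auto simp: follows_def dest: derives_formula)

lemma derives_Crisp: "derives ar \<Sigma> \<phi> \<Longrightarrow> derives ar \<Sigma> (\<^bold>\<Gamma> \<phi>)"
  by (rule derives_step[of "[\<phi>]"]) (auto simp: follows_def dest: derives_formula)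

lemma derives_exists:
  fixes \<phi> :: "('m::{finite,de_morgan_algebra}, 'i) fm"
  shows "derives ar \<Sigma> (\<theta> \<^bold>\<Rightarrow> \<phi>) \<Longrightarrow> k \<notin> Fv \<phi> \<Longrightarrow> derives ar \<Sigma> (Exi k \<theta> \<^bold>\<Rightarrow> \<phi>)"
  by (rule derives_step[of "[\<theta> \<^bold>\<Rightarrow> \<phi>]"]) (auto simp: follows_def dest: derives_formula)

text \<open>
  The implication \<open>\<phi> \<rightarrow> \<gamma>\<^sub>1 \<phi>\<close> is in general no tautology, since \<open>\<phi>\<close> may be neither \<open>0\<close> nor \<open>1\<close>. It becomes one under
  the hypothesis \<open>\<Gamma>\<phi>\<close>, and this hypothesis is what the \<open>\<Gamma>\<close>-rule provides.
\<close>

lemma derives_Gam_one: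
  assumes "derives ar \<Sigma> \<phi>"
  shows "derives ar \<Sigma> (Gam 1 \<phi>)"
proof -
  have f: "is_formula ar \<phi>" using assms by (rule derives_formula)
  have "tautology (\<^bold>\<Gamma> \<phi> \<^bold>\<longrightarrow> (\<phi> \<^bold>\<longrightarrow> Gam 1 \<phi>))"
    by (auto simp: tautology_def dm_simps)
  then have "derives ar \<Sigma> (\<^bold>\<Gamma> \<phi> \<^bold>\<longrightarrow> (\<phi> \<^bold>\<longrightarrow> Gam 1 \<phi>))"
    using f by (intro derives_axiom ax_taut) auto
  with assms derives_Crisp[OF assms] show ?thesis by (blast intro: derives_mp)
qed

text \<open>
  The hypotheses are discharged one at a time. It is essential to discharge \<open>\<gamma>\<^sub>1 \<psi>\<close> and not \<open>\<psi>\<close>: at a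
  valuation where \<open>\<psi>\<close> is neither \<open>0\<close> nor \<open>1\<close>, the implication \<open>\<psi> \<rightarrow> \<phi>\<close> need not have the value \<open>1\<close>.
\<close>

lemma derives_consequence:
  assumes "\<forall>\<psi>\<in>set ps. derives ar \<Sigma> \<psi>" and "is_formula ar \<phi>"
    and "\<And>v. \<forall>\<psi>\<in>set ps. tval \<psi> v = 1 \<Longrightarrow> tval \<phi> v = 1"
  shows "derives ar \<Sigma> \<phi>"
  using assms
proof (induction ps arbitrary: \<phi>)
  case Nil
  then show ?case by (intro derives_axiom ax_taut) (auto simp: tautology_def)
next
  case (Cons \<psi> ps)
  have "derives ar \<Sigma> (Gam 1 \<psi> \<^bold>\<longrightarrow> \<phi>)"
  proof (rule Cons.IH)
    show "is_formula ar (Gam 1 \<psi> \<^bold>\<longrightarrow> \<phi>)"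
      using Cons.prems by (auto dest: derives_formula)
    show "tval (Gam 1 \<psi> \<^bold>\<longrightarrow> \<phi>) v = 1" if "\<forall>\<psi>\<in>set ps. tval \<psi> v = 1" for v
      using Cons.prems(3)[of v] that by (auto simp: dm_simps)
  qed (use Cons.prems in auto)
  moreover have "derives ar \<Sigma> (Gam 1 \<psi>)"
    using Cons.prems(1) by (simp add: derives_Gam_one)
  ultimately show ?case by (rule derives_mp[rotated])
qed

section \<open>Points of a theory\<close>

definition points :: "('i \<Rightarrow> nat) \<Rightarrow> ('m::de_morgan_algebra, 'i) fm set \<Rightarrow> (('m, 'i) fm \<Rightarrow> 'm) set" where
  "points ar \<Sigma> = {v. \<forall>\<phi>. derives ar \<Sigma> \<phi> \<longrightarrow> tval \<phi> v = 1}"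

text \<open>
  Compactness for points: the derivable formulas can be added to the formulas to be satisfied.
\<close>

lemma points_extension:
  fixes \<Sigma> :: "('m::{finite,de_morgan_algebra}, 'i) fm set"
  assumes "\<And>D. finite D \<Longrightarrow> D \<subseteq> \<Delta> \<Longrightarrow> \<exists>v\<in>points ar \<Sigma>. \<forall>\<phi>\<in>D. tval \<phi> v = 1"
  shows "\<exists>v\<in>points ar \<Sigma>. \<forall>\<phi>\<in>\<Delta>. tval \<phi> v = 1"
proof -
  have "\<exists>v. \<forall>\<phi>\<in>{\<phi>. derives ar \<Sigma> \<phi>} \<union> \<Delta>. tval \<phi> v = 1"
  proof (rule valuation_compactness)
    fix D assume D: "finite D" "D \<subseteq> {\<phi>. derives ar \<Sigma> \<phi>} \<union> \<Delta>"
    obtain v where "v \<in> points ar \<Sigma>" "\<forall>\<phi>\<in>D \<inter> \<Delta>. tval \<phi> v = 1"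
      using assms[of "D \<inter> \<Delta>"] D(1) by auto
    then show "\<exists>v. \<forall>\<phi>\<in>D. tval \<phi> v = 1"
      using D(2) by (auto simp: points_def)
  qed
  then show ?thesis by (auto simp: points_def)
qed

text \<open>
  Completeness of the proof system for propositional consequence from \<open>\<Sigma>\<close>. If \<open>\<phi>\<close> is not
  derivable, then by \<open>derives_consequence\<close> each finite set of derivable formulas has a valuation
  at which \<open>\<phi>\<close> does not have the value \<open>1\<close>, and compactness turns these valuations into one point.
\<close>

lemma derives_iff_points:
  fixes \<Sigma> :: "('m::{finite,de_morgan_algebra}, 'i) fm set"
  assumes "is_formula ar \<phi>"
  shows "derives ar \<Sigma> \<phi> \<longleftrightarrow> (\<forall>v\<in>points ar \<Sigma>. tval \<phi> v = 1)"
proof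
  show "derives ar \<Sigma> \<phi> \<Longrightarrow> \<forall>v\<in>points ar \<Sigma>. tval \<phi> v = 1"
    by (simp add: points_def)
next
  assume valid: "\<forall>v\<in>points ar \<Sigma>. tval \<phi> v = 1"
  show "derives ar \<Sigma> \<phi>"
  proof (rule ccontr)
    assume not: "\<not> derives ar \<Sigma> \<phi>"
    have "\<exists>v. \<forall>\<psi>\<in>insert (\<^bold>\<not> (Gam 1 \<phi>)) {\<psi>. derives ar \<Sigma> \<psi>}. tval \<psi> v = 1"
    proof (rule valuation_compactness)
      fix D assume D: "finite D" "D \<subseteq> insert (\<^bold>\<not> (Gam 1 \<phi>)) {\<psi>. derives ar \<Sigma> \<psi>}"
      obtain ps where ps: "set ps = D - {\<^bold>\<not> (Gam 1 \<phi>)}"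
        using D(1) by (meson finite_Diff finite_list)
      have "\<exists>v. (\<forall>\<psi>\<in>set ps. tval \<psi> v = 1) \<and> tval \<phi> v \<noteq> 1"
        using derives_consequence[of ps ar \<Sigma> \<phi>] not assms D(2) ps by blast
      then show "\<exists>v. \<forall>\<psi>\<in>D. tval \<psi> v = 1"
        unfolding ps by (auto simp: dm_simps) (metis Diff_iff singletonD tval.simps(4) tval.simps(8) uminus_zero)
    qed
    then obtain v where "v \<in> points ar \<Sigma>" "tval (\<^bold>\<not> (Gam 1 \<phi>)) v = 1"
      by (auto simp: points_def)
    with valid show False by (simp add: uminus_one)
  qed
qed

lemma point_axiom:
  assumes "v \<in> points ar \<Sigma>" "is_axiom ar \<phi>" "is_formula ar \<phi>"
  shows "tval \<phi> v = 1"
  using assms derives_axiom by (auto simp: points_def)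

text \<open>
  At a point, an axiom \<open>\<theta> \<Leftrightarrow> \<phi>\<close> is an equation between values, since \<open>\<theta> \<Rightarrow> \<phi>\<close> has the value \<open>1\<close> if the
  value of \<open>\<theta>\<close> lies below that of \<open>\<phi>\<close> and the value \<open>0\<close> otherwise.
\<close>

lemma point_Same:
  fixes \<phi> :: "('m::{finite,de_morgan_algebra}, 'i) fm"
  assumes "v \<in> points ar \<Sigma>" "is_axiom ar (\<theta> \<^bold>\<Leftrightarrow> \<phi>)" "is_formula ar \<theta>" "is_formula ar \<phi>"
  shows "tval \<theta> v = tval \<phi> v"
proof -
  have "tval (\<theta> \<^bold>\<Leftrightarrow> \<phi>) v = 1" using assms by (intro point_axiom) auto
  then show ?thesis by (simp split: if_splits)
qed

section \<open>Quantifiers and equality at the points of a theory\<close>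

text \<open>
  At points, the values of prime formulas are governed by the axioms. Unfolding them to
  applications of the valuation would hide the formulas from the rewrite rules below.
\<close>

declare tval.simps(1,2,7) [simp del]

context
  fixes ar :: "'i \<Rightarrow> nat" and \<Sigma> :: "('m::{finite,de_morgan_algebra}, 'i) fm set"
begin

abbreviation pts where "pts \<equiv> points ar \<Sigma>"

text \<open>
  The \<open>\<exists>\<close>-rule read at points. The hypothesis has to hold at all points, because the rule applies
  to derivable formulas only.
\<close>

lemma exists_le:
  assumes "\<And>u. u \<in> pts \<Longrightarrow> tval \<theta> u \<le> tval \<phi> u" "k \<notin> Fv \<phi>"
    and "is_formula ar \<theta>" "is_formula ar \<phi>" "v \<in> pts"
  shows "tval (Exi k \<theta>) v \<le> tval \<phi> v"
proof -
  have "derives ar \<Sigma> (\<theta> \<^bold>\<Rightarrow> \<phi>)"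
    using assms by (subst derives_iff_points) auto
  then have "derives ar \<Sigma> (Exi k \<theta> \<^bold>\<Rightarrow> \<phi>)"
    using assms(2) by (rule derives_exists)
  then have "tval (Exi k \<theta> \<^bold>\<Rightarrow> \<phi>) v = 1"
    using assms(5) unfolding points_def by blast
  then show ?thesis by (simp split: if_splits)
qed

lemma le_exists:
  assumes "v \<in> pts" "is_formula ar \<phi>"
  shows "tval \<phi> v \<le> tval (Exi k \<phi>) v"
  using point_Same[OF assms(1) ax7] assms(2) by (simp add: le_iff_add)

lemma exists_mono:
  assumes "\<And>u. u \<in> pts \<Longrightarrow> tval \<phi> u \<le> tval \<theta> u"
    and "is_formula ar \<phi>" "is_formula ar \<theta>" "v \<in> pts"
  shows "tval (Exi k \<phi>) v \<le> tval (Exi k \<theta>) v"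
proof (rule exists_le)
  show "tval \<phi> u \<le> tval (Exi k \<theta>) u" if "u \<in> pts" for u
    using assms(1)[OF that] le_exists[OF that assms(3)] by (rule order_trans)
qed (use assms in auto)

lemma exists_cong:
  assumes "\<And>u. u \<in> pts \<Longrightarrow> tval \<phi> u = tval \<theta> u"
    and "is_formula ar \<phi>" "is_formula ar \<theta>" "v \<in> pts"
  shows "tval (Exi k \<phi>) v = tval (Exi k \<theta>) v"
  using assms by (intro order.antisym exists_mono) auto

lemma exists_free:
  assumes "k \<notin> Fv \<phi>" "is_formula ar \<phi>" "v \<in> pts"
  shows "tval (Exi k \<phi>) v = tval \<phi> v"
  using assms by (intro order.antisym exists_le le_exists) auto

lemma exists_conj:
  assumes "k \<notin> Fv \<theta>" "is_formula ar \<phi>" "is_formula ar \<theta>" "v \<in> pts"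
  shows "tval (Exi k (\<phi> \<^bold>\<and> \<theta>)) v = tval (Exi k \<phi>) v * tval \<theta> v"
proof -
  have "tval (Exi k (\<phi> \<^bold>\<and> \<theta>)) v = tval (Exi k (\<phi> \<^bold>\<and> Exi k \<theta>)) v"
    using assms exists_free[OF assms(1,3)] by (intro exists_cong) auto
  also have "\<dots> = tval (Exi k \<phi>) v * tval (Exi k \<theta>) v"
    using point_Same[OF assms(4) ax8] assms by simp
  finally show ?thesis using exists_free[OF assms(1,3,4)] by simp
qed

lemma exists_disj:
  assumes "is_formula ar \<phi>" "is_formula ar \<theta>" "v \<in> pts"
  shows "tval (Exi k (\<phi> \<^bold>\<or> \<theta>)) v \<le> tval (Exi k \<phi>) v + tval (Exi k \<theta>) v"
proof -
  have "tval (Exi k (\<phi> \<^bold>\<or> \<theta>)) v \<le> tval (Exi k \<phi> \<^bold>\<or> Exi k \<theta>) v"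
  proof (rule exists_le)
    show "tval (\<phi> \<^bold>\<or> \<theta>) u \<le> tval (Exi k \<phi> \<^bold>\<or> Exi k \<theta>) u" if "u \<in> pts" for u
      using le_exists[OF that assms(1), of k] le_exists[OF that assms(2), of k]
      by (auto intro!: add_le intro: order_trans le_add1 le_add2)
  qed (use assms in auto)
  then show ?thesis by simp
qed

lemma exists_commute:
  assumes "is_formula ar \<phi>" "v \<in> pts"
  shows "tval (Exi k (Exi l \<phi>)) v = tval (Exi l (Exi k \<phi>)) v"
  using point_Same[OF assms(2) ax9] assms(1) by simp

text \<open>
  The two-valued formulas. For these the axioms are those of classical logic with equality; other
  formulas are reached through \<open>\<gamma>\<^sub>p \<phi>\<close>, which is always crisp.
\<close>

definition crisp :: "('m, 'i) fm \<Rightarrow> bool" where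
  "crisp \<chi> \<longleftrightarrow> is_formula ar \<chi> \<and> (\<forall>v\<in>pts. tval \<chi> v \<in> {0, 1})"

lemma crispD: "crisp \<chi> \<Longrightarrow> v \<in> pts \<Longrightarrow> tval \<chi> v = 0 \<or> tval \<chi> v = 1"
  by (auto simp: crisp_def)

lemma crisp_formula: "crisp \<chi> \<Longrightarrow> is_formula ar \<chi>"
  by (simp add: crisp_def)

lemma crisp_Gam: "is_formula ar \<phi> \<Longrightarrow> crisp (Gam p \<phi>)"
  by (simp add: crisp_def)

lemma crisp_Neg: "crisp \<chi> \<Longrightarrow> crisp (\<^bold>\<not> \<chi>)"
  by (auto simp: crisp_def dm_simps)

lemma crisp_And:
  assumes "crisp \<chi>" "crisp \<psi>"
  shows "crisp (\<chi> \<^bold>\<and> \<psi>)"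
  unfolding crisp_def
proof (intro conjI ballI)
  fix v assume v: "v \<in> pts"
  from crispD[OF assms(1) v] crispD[OF assms(2) v] show "tval (\<chi> \<^bold>\<and> \<psi>) v \<in> {0, 1}"
    by (auto simp: dm_simps)
qed (use assms in \<open>simp add: crisp_formula\<close>)

lemma crisp_Or:
  assumes "crisp \<chi>" "crisp \<psi>"
  shows "crisp (\<chi> \<^bold>\<or> \<psi>)"
  unfolding crisp_def
proof (intro conjI ballI)
  fix v assume v: "v \<in> pts"
  from crispD[OF assms(1) v] crispD[OF assms(2) v] show "tval (\<chi> \<^bold>\<or> \<psi>) v \<in> {0, 1}"
    by (auto simp: dm_simps)
qed (use assms in \<open>simp add: crisp_formula\<close>)

lemma crisp_Exi:
  assumes "crisp \<chi>"
  shows "crisp (Exi k \<chi>)"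
  unfolding crisp_def
proof (intro conjI ballI)
  show f: "is_formula ar (Exi k \<chi>)" using assms by (simp add: crisp_def)
  fix v assume v: "v \<in> pts"
  have "tval (Exi k \<chi>) v = tval (Exi k (Gam 1 \<chi>)) v"
    using assms v by (intro exists_cong) (auto simp: crisp_def)
  moreover have "tval (Gam 1 (Exi k (Gam 1 \<chi>))) v = tval (Exi k (Gam 1 \<chi>)) v"
    using v f by (intro point_Same[OF v ax2]) auto
  ultimately show "tval (Exi k \<chi>) v \<in> {0, 1}" by (metis crisp_Gam crispD insertCI tval.simps(8))
qed

lemma crisp_Eq: "crisp (k \<^bold>\<approx> l)"
  unfolding crisp_def
proof (intro conjI ballI)
  fix v assume v: "v \<in> pts"
  have "tval (Gam 1 (k \<^bold>\<approx> l)) v = tval (k \<^bold>\<approx> l) v"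
    by (intro point_Same[OF v ax3]) auto
  then show "tval (k \<^bold>\<approx> l) v \<in> {0, 1}" by (auto split: if_splits)
qed simp

lemma crisp_Subst: "crisp \<chi> \<Longrightarrow> crisp (Subst k l \<chi>)"
  unfolding Subst_def by (intro crisp_Exi crisp_And crisp_Eq)

lemma equal_refl: "v \<in> pts \<Longrightarrow> tval (k \<^bold>\<approx> k) v = 1"
  using point_Same[OF _ ax10] by fastforce

lemma equal_through:
  assumes "v \<in> pts" "k \<notin> {l, m}"
  shows "tval (l \<^bold>\<approx> m) v = tval (Exi k ((l \<^bold>\<approx> k) \<^bold>\<and> (k \<^bold>\<approx> m))) v"
  using assms by (intro point_Same[OF assms(1) ax11]) auto

text \<open>
  Going from \<open>v\<^sub>l\<close> to itself through \<open>v\<^sub>k\<close> provides an element equal to \<open>v\<^sub>l\<close>.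
\<close>

lemma exists_eq:
  assumes "v \<in> pts" "k \<noteq> l"
  shows "tval (Exi k (k \<^bold>\<approx> l)) v = 1"
proof -
  have "1 = tval (Exi k ((l \<^bold>\<approx> k) \<^bold>\<and> (k \<^bold>\<approx> l))) v"
    using equal_through[of v k l l] equal_refl[OF assms(1), of l] assms by simp
  also have "\<dots> \<le> tval (Exi k (k \<^bold>\<approx> l)) v"
    using assms by (intro exists_mono) (auto simp: mult_le2)
  finally show ?thesis by (simp add: dm_simps)
qed

lemma Subst_mono:
  assumes "\<And>u. u \<in> pts \<Longrightarrow> tval \<phi> u \<le> tval \<theta> u"
    and "is_formula ar \<phi>" "is_formula ar \<theta>" "v \<in> pts"
  shows "tval (Subst k l \<phi>) v \<le> tval (Subst k l \<theta>) v"
  unfolding Subst_def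
proof (rule exists_mono)
  show "tval (k \<^bold>\<approx> l \<^bold>\<and> \<phi>) u \<le> tval (k \<^bold>\<approx> l \<^bold>\<and> \<theta>) u" if "u \<in> pts" for u
    using order_trans[OF mult_le2 assms(1)[OF that]] by (auto intro!: le_mult simp: mult_le1)
qed (use assms in auto)

lemma Subst_cong:
  assumes "\<And>u. u \<in> pts \<Longrightarrow> tval \<phi> u = tval \<theta> u"
    and "is_formula ar \<phi>" "is_formula ar \<theta>" "v \<in> pts"
  shows "tval (Subst k l \<phi>) v = tval (Subst k l \<theta>) v"
  using assms by (intro order.antisym Subst_mono) auto

lemma Subst_free:
  assumes "k \<notin> Fv \<phi>" "k \<noteq> l" "is_formula ar \<phi>" "v \<in> pts"
  shows "tval (Subst k l \<phi>) v = tval \<phi> v"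
  using assms exists_conj[of k \<phi> "k \<^bold>\<approx> l" v] exists_eq by (simp add: Subst_def)

text \<open>
  That an element is equal to \<open>v\<^sub>l\<close> and has \<open>\<chi>\<close> excludes that one equal to \<open>v\<^sub>l\<close> lacks \<open>\<chi>\<close>, by axiom;
  and one of the two holds because some element is equal to \<open>v\<^sub>l\<close>.
\<close>

lemma Subst_Neg:
  assumes "crisp \<chi>" "k \<noteq> l" "v \<in> pts"
  shows "tval (Subst k l (\<^bold>\<not> \<chi>)) v = - tval (Subst k l \<chi>) v"
proof -
  have f: "is_formula ar \<chi>" using assms by (simp add: crisp_def)
  have "tval (Subst k l (Gam 1 \<chi>)) v * tval (Subst k l (\<^bold>\<not> (Gam 1 \<chi>))) v = 0"
    using point_Same[OF assms(3) ax12[OF assms(2), of ar \<chi>]] f by (simp add: Subst_def)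
  moreover have "tval (Subst k l (Gam 1 \<chi>)) v = tval (Subst k l \<chi>) v"
    using assms f by (intro Subst_cong) (auto dest: crispD)
  moreover have "tval (Subst k l (\<^bold>\<not> (Gam 1 \<chi>))) v = tval (Subst k l (\<^bold>\<not> \<chi>)) v"
    using assms f by (intro Subst_cong) (auto dest: crispD)
  ultimately have prod: "tval (Subst k l \<chi>) v * tval (Subst k l (\<^bold>\<not> \<chi>)) v = 0" by simp
  have "1 = tval (Exi k (k \<^bold>\<approx> l)) v" using assms by (simp add: exists_eq)
  also have "\<dots> \<le> tval (Exi k ((k \<^bold>\<approx> l \<^bold>\<and> \<chi>) \<^bold>\<or> (k \<^bold>\<approx> l \<^bold>\<and> (\<^bold>\<not> \<chi>)))) v"
  proof (rule exists_mono)
    show "tval (k \<^bold>\<approx> l) u \<le> tval ((k \<^bold>\<approx> l \<^bold>\<and> \<chi>) \<^bold>\<or> (k \<^bold>\<approx> l \<^bold>\<and> (\<^bold>\<not> \<chi>))) u" if "u \<in> pts" for u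
      using crispD[OF assms(1) that] by (auto simp: dm_simps)
  qed (use assms f in auto)
  also have "\<dots> \<le> tval (Subst k l \<chi>) v + tval (Subst k l (\<^bold>\<not> \<chi>)) v"
    unfolding Subst_def using assms f by (intro exists_disj) auto
  finally have sum: "tval (Subst k l \<chi>) v + tval (Subst k l (\<^bold>\<not> \<chi>)) v = 1"
    by (simp add: dm_simps)
  show ?thesis
    using crispD[OF crisp_Subst[OF assms(1)] assms(3), of k l] prod sum
    by (metis add_0_left mult_1_left uminus_one uminus_zero)
qed

lemma le_Subst:
  assumes "v \<in> pts" "tval (k \<^bold>\<approx> l) v = 1" "is_formula ar \<phi>"
  shows "tval \<phi> v \<le> tval (Subst k l \<phi>) v"
  using le_exists[OF assms(1), of "k \<^bold>\<approx> l \<^bold>\<and> \<phi>" k] assms by (simp add: Subst_def)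

text \<open>
  Substituting in \<open>v\<^sub>l \<approx> v\<^sub>k\<close> itself gives \<open>\<exists>v\<^sub>k (v\<^sub>l \<approx> v\<^sub>k \<and> v\<^sub>k \<approx> v\<^sub>l)\<close>, which is \<open>v\<^sub>l \<approx> v\<^sub>l\<close>. Hence the
  substitution in its negation fails, and this is only possible if \<open>v\<^sub>k \<approx> v\<^sub>l\<close> forces \<open>v\<^sub>l \<approx> v\<^sub>k\<close>.
\<close>

lemma equal_sym:
  assumes "v \<in> pts" "tval (k \<^bold>\<approx> l) v = 1"
  shows "tval (l \<^bold>\<approx> k) v = 1"
proof (cases "k = l")
  case False
  have "tval (Subst k l (l \<^bold>\<approx> k)) v = tval (Exi k ((l \<^bold>\<approx> k) \<^bold>\<and> (k \<^bold>\<approx> l))) v"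
    unfolding Subst_def using assms(1) by (intro exists_cong) (auto simp: mult.commute)
  also have "\<dots> = 1"
    using equal_through[of v k l l] equal_refl[OF assms(1), of l] assms False by simp
  finally have "tval (Subst k l (\<^bold>\<not> (l \<^bold>\<approx> k))) v = 0"
    using Subst_Neg[OF crisp_Eq False assms(1)] by (simp add: dm_simps)
  with le_Subst[OF assms, of "\<^bold>\<not> (l \<^bold>\<approx> k)"] have "tval (\<^bold>\<not> (l \<^bold>\<approx> k)) v = 0"
    by (simp add: dm_simps)
  then show ?thesis by (simp add: uminus_eq_iff dm_simps)
qed (use assms in simp)

lemma equal_trans:
  assumes "v \<in> pts" "tval (l \<^bold>\<approx> k) v = 1" "tval (k \<^bold>\<approx> m) v = 1"
  shows "tval (l \<^bold>\<approx> m) v = 1"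
proof (cases "k \<in> {l, m}")
  case False
  then show ?thesis
    using le_exists[OF assms(1), of "(l \<^bold>\<approx> k) \<^bold>\<and> (k \<^bold>\<approx> m)" k] equal_through[of v k l m] assms
    by (simp add: dm_simps)
qed (use assms in auto)

text \<open>
  This carries information about crisp formulas over to formulas with arbitrary values: if \<open>\<chi>\<close>
  holds of the element named by \<open>v\<^sub>l\<close>, and \<open>\<chi>\<close> determines the value of \<open>\<phi>\<close> at every point, then the
  substituted \<open>\<phi>\<close> has that value. The upper bound uses that \<open>v\<^sub>k \<approx> v\<^sub>l \<and> \<phi>\<close> lies below
  \<open>t\<^sub>p \<or> S\<^sup>k\<^sub>l \<not>\<chi>\<close>, where \<open>v\<^sub>k\<close> is not free; the lower bound pulls \<open>t\<^sub>p\<close> out of the quantifier.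
\<close>

lemma Subst_value:
  assumes "v \<in> pts" "k \<noteq> l" "crisp \<chi>" "tval (Subst k l \<chi>) v = 1" "is_formula ar \<phi>"
    and det: "\<And>u. u \<in> pts \<Longrightarrow> tval \<chi> u = 1 \<Longrightarrow> tval \<phi> u = p"
  shows "tval (Subst k l \<phi>) v = p"
proof (rule order.antisym)
  note f = crisp_formula[OF assms(3)]
  have zero: "tval (Subst k l (\<^bold>\<not> \<chi>)) v = 0"
    using Subst_Neg[OF assms(3,2,1)] assms(4) by (simp add: dm_simps)
  have "tval (Subst k l \<phi>) v \<le> tval (Val p \<^bold>\<or> Subst k l (\<^bold>\<not> \<chi>)) v"
    unfolding Subst_def[of k l \<phi>]
  proof (rule exists_le)
    fix u assume u: "u \<in> pts"
    show "tval (k \<^bold>\<approx> l \<^bold>\<and> \<phi>) u \<le> tval (Val p \<^bold>\<or> Subst k l (\<^bold>\<not> \<chi>)) u"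
    proof (cases "tval \<chi> u = 1 \<or> tval (k \<^bold>\<approx> l) u = 0")
      case True
      then show ?thesis
        using det[OF u] by (auto simp: dm_simps intro: order_trans[OF mult_le2 le_add1])
    next
      case False
      then have "tval (k \<^bold>\<approx> l) u = 1" "tval \<chi> u = 0"
        using crispD[OF crisp_Eq u] crispD[OF assms(3) u] by blast+
      then have "tval (Subst k l (\<^bold>\<not> \<chi>)) u = 1"
        using le_Subst[OF u, of k l "\<^bold>\<not> \<chi>"] f by (simp add: dm_simps)
      then show ?thesis by (simp add: dm_simps)
    qed
  qed (use assms f in auto)
  then show "tval (Subst k l \<phi>) v \<le> p" using zero by simp
next
  note f = crisp_formula[OF assms(3)]
  have "p = tval (Exi k ((k \<^bold>\<approx> l \<^bold>\<and> \<chi>) \<^bold>\<and> Val p)) v"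
    using assms f by (subst exists_conj) (auto simp: Subst_def)
  also have "\<dots> \<le> tval (Subst k l \<phi>) v"
    unfolding Subst_def
  proof (rule exists_mono)
    show "tval ((k \<^bold>\<approx> l \<^bold>\<and> \<chi>) \<^bold>\<and> Val p) u \<le> tval (k \<^bold>\<approx> l \<^bold>\<and> \<phi>) u" if u: "u \<in> pts" for u
      using det[OF u] crispD[OF assms(3) u] by (auto simp: dm_simps)
  qed (use assms f in auto)
  finally show "p \<le> tval (Subst k l \<phi>) v" .
qed

lemma Subst_And_crisp:
  assumes "v \<in> pts" "k \<noteq> l" "crisp \<chi>" "crisp \<psi>"
    "tval (Subst k l \<chi>) v = 1" "tval (Subst k l \<psi>) v = 1"
  shows "tval (Subst k l (\<chi> \<^bold>\<and> \<psi>)) v = 1"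
proof -
  note f = crisp_formula[OF assms(3)] crisp_formula[OF assms(4)]
  have "tval (Subst k l (\<^bold>\<not> (\<chi> \<^bold>\<and> \<psi>))) v
      \<le> tval (Subst k l (\<^bold>\<not> \<chi>)) v + tval (Subst k l (\<^bold>\<not> \<psi>)) v"
  proof -
    have "tval (Subst k l (\<^bold>\<not> (\<chi> \<^bold>\<and> \<psi>))) v
        \<le> tval (Exi k ((k \<^bold>\<approx> l \<^bold>\<and> (\<^bold>\<not> \<chi>)) \<^bold>\<or> (k \<^bold>\<approx> l \<^bold>\<and> (\<^bold>\<not> \<psi>)))) v"
      unfolding Subst_def using assms f
      by (intro exists_mono) (auto simp: uminus_mult mult_add_distrib)
    also have "\<dots> \<le> tval (Subst k l (\<^bold>\<not> \<chi>)) v + tval (Subst k l (\<^bold>\<not> \<psi>)) v"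
      unfolding Subst_def using assms f by (intro exists_disj) auto
    finally show ?thesis .
  qed
  then have "- tval (Subst k l (\<chi> \<^bold>\<and> \<psi>)) v = 0"
    using assms by (simp add: Subst_Neg crisp_And dm_simps)
  then show ?thesis by (simp add: uminus_eq_iff dm_simps)
qed

text \<open>
  At every point with \<open>v\<^sub>k \<approx> v\<^sub>l\<close>, the formula \<open>\<phi>\<close> has some value \<open>p\<close>, so that \<open>S\<^sup>k\<^sub>l \<gamma>\<^sub>p \<phi>\<close> holds. Thus
  \<open>v\<^sub>k \<approx> v\<^sub>l\<close> lies below the disjunction of these formulas over all \<open>p\<close>, and \<open>\<exists>v\<^sub>k (v\<^sub>k \<approx> v\<^sub>l)\<close> has the
  value \<open>1\<close>.
\<close>

lemma Subst_Gam_exists: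
  assumes "v \<in> pts" "k \<noteq> l" "is_formula ar \<phi>"
  shows "\<exists>p. tval (Subst k l (Gam p \<phi>)) v = 1"
proof (rule ccontr)
  let ?B = "BigOr UNIV (\<lambda>p. Subst k l (Gam p \<phi>))"
  note crisp = crispD[OF crisp_Subst[OF crisp_Gam[OF assms(3)]]]
  have B: "tval ?B u = (if \<exists>p. tval (Subst k l (Gam p \<phi>)) u = 1 then 1 else 0)" if "u \<in> pts" for u
    using crisp[OF that] by (subst tval_BigOr) auto
  assume "\<not> ?thesis"
  then have "tval ?B v = 0" using B[OF assms(1)] by simp
  moreover have "tval (Exi k (k \<^bold>\<approx> l)) v \<le> tval ?B v"
  proof (rule exists_le)
    fix u assume u: "u \<in> pts"
    have "tval ?B u = 1" if "tval (k \<^bold>\<approx> l) u = 1"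
      using le_Subst[OF u that, of "Gam (tval \<phi> u) \<phi>"] assms(3) B[OF u]
      by (auto simp: dm_simps)
    then show "tval (k \<^bold>\<approx> l) u \<le> tval ?B u"
      using crispD[OF crisp_Eq u, of k l] by (auto simp: dm_simps)
  qed (use assms in \<open>auto simp: Fv_BigOr formula_BigOr\<close>)
  ultimately show False using exists_eq[OF assms(1,2)] by (simp add: dm_simps)
qed

text \<open>
  The valuation that describes the same structure after \<open>v\<^sub>k\<close> has been reassigned to the element
  named by \<open>v\<^sub>l\<close>.
\<close>

definition shift :: "nat \<Rightarrow> nat \<Rightarrow> (('m, 'i) fm \<Rightarrow> 'm) \<Rightarrow> (('m, 'i) fm \<Rightarrow> 'm)" where
  "shift k l v = (\<lambda>\<psi>. tval (Subst k l \<psi>) v)"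

text \<open>
  Substitution commutes with all propositional connectives: the values \<open>p\<close> with \<open>S\<^sup>k\<^sub>l \<gamma>\<^sub>p\<close> of the
  components exist, and a conjunction of two such crisp formulas determines the value of the
  compound formula.
\<close>

lemma tval_shift:
  assumes "v \<in> pts" "k \<noteq> l"
  shows "is_formula ar \<phi> \<Longrightarrow> tval \<phi> (shift k l v) = tval (Subst k l \<phi>) v"
proof (induction \<phi>)
  case (Val p)
  show ?case
    using assms exists_conj[of k "Val p" "k \<^bold>\<approx> l" v] exists_eq[OF assms] Subst_free[of k "Val p" l v] by simp
next
  case (Neg \<phi>)
  then obtain p where p: "tval (Subst k l (Gam p \<phi>)) v = 1"
    using Subst_Gam_exists assms by fastforce
  have "tval (Subst k l \<phi>) v = p" "tval (Subst k l (\<^bold>\<not> \<phi>)) v = - p"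
    using Neg.prems by (auto intro!: Subst_value[OF assms crisp_Gam p] split: if_splits)
  then show ?case using Neg by simp
next
  case (And \<phi> \<theta>)
  then obtain p q where pq: "tval (Subst k l (Gam p \<phi>)) v = 1" "tval (Subst k l (Gam q \<theta>)) v = 1"
    using Subst_Gam_exists assms by fastforce
  have c: "crisp (Gam p \<phi>)" "crisp (Gam q \<theta>)" using And.prems by (auto intro: crisp_Gam)
  have "tval (Subst k l \<phi>) v = p" "tval (Subst k l \<theta>) v = q"
    by (rule Subst_value[OF assms c(1) pq(1)] Subst_value[OF assms c(2) pq(2)],
        use And.prems in \<open>auto split: if_splits\<close>)+
  moreover have "tval (Subst k l (\<phi> \<^bold>\<and> \<theta>)) v = p * q"
    using And.prems
    by (intro Subst_value[OF assms crisp_And Subst_And_crisp[OF assms _ _ pq]] c)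
       (auto split: if_splits simp: dm_simps)
  ultimately show ?case using And by simp
next
  case (Or \<phi> \<theta>)
  then obtain p q where pq: "tval (Subst k l (Gam p \<phi>)) v = 1" "tval (Subst k l (Gam q \<theta>)) v = 1"
    using Subst_Gam_exists assms by fastforce
  have c: "crisp (Gam p \<phi>)" "crisp (Gam q \<theta>)" using Or.prems by (auto intro: crisp_Gam)
  have "tval (Subst k l \<phi>) v = p" "tval (Subst k l \<theta>) v = q"
    by (rule Subst_value[OF assms c(1) pq(1)] Subst_value[OF assms c(2) pq(2)],
        use Or.prems in \<open>auto split: if_splits\<close>)+
  moreover have "tval (Subst k l (\<phi> \<^bold>\<or> \<theta>)) v = p + q"
    using Or.prems
    by (intro Subst_value[OF assms crisp_And Subst_And_crisp[OF assms _ _ pq]] c)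
       (auto split: if_splits simp: dm_simps)
  ultimately show ?case using Or by simp
next
  case (Gam r \<phi>)
  then obtain p where p: "tval (Subst k l (Gam p \<phi>)) v = 1"
    using Subst_Gam_exists assms by fastforce
  have "tval (Subst k l \<phi>) v = p" "tval (Subst k l (Gam r \<phi>)) v = (if p = r then 1 else 0)"
    using Gam.prems by (auto intro!: Subst_value[OF assms crisp_Gam p] split: if_splits)
  then show ?case using Gam by simp
qed (simp_all add: shift_def tval.simps(1,2,7))

lemma shift_point:
  assumes "v \<in> pts" "k \<noteq> l"
  shows "shift k l v \<in> pts"
  unfolding points_def
proof (intro CollectI allI impI)
  fix \<phi> assume d: "derives ar \<Sigma> \<phi>"
  have "tval (Subst k l \<phi>) v = tval (Subst k l (Val 1)) v"
    using assms d derives_formula[OF d] by (intro Subst_cong) (auto simp: points_def)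
  also have "\<dots> = 1" using Subst_free[of k "Val 1" l v] assms by simp
  finally show "tval \<phi> (shift k l v) = 1"
    using tval_shift[OF assms] derives_formula[OF d] by simp
qed

lemma shift_eq:
  assumes "v \<in> pts" "k \<noteq> l"
  shows "tval (k \<^bold>\<approx> l) (shift k l v) = 1"
proof -
  have "tval (Subst k l (k \<^bold>\<approx> l)) v = tval (Exi k (k \<^bold>\<approx> l)) v"
    unfolding Subst_def using assms by (intro exists_cong) (auto simp: mult_self)
  then show ?thesis using tval_shift[OF assms, of "k \<^bold>\<approx> l"] exists_eq[OF assms] by simp
qed

lemma shift_free:
  assumes "v \<in> pts" "k \<noteq> l" "k \<notin> Fv \<psi>" "is_formula ar \<psi>"
  shows "tval \<psi> (shift k l v) = tval \<psi> v"
  using assms tval_shift Subst_free by simp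

lemma Subst_at_eq:
  assumes "v \<in> pts" "k \<noteq> l" "tval (k \<^bold>\<approx> l) v = 1" "is_formula ar \<phi>"
  shows "tval (Subst k l \<phi>) v = tval \<phi> v"
proof (rule Subst_value[OF assms(1,2)])
  show "tval (Subst k l (Gam (tval \<phi> v) \<phi>)) v = 1"
    using le_Subst[OF assms(1,3), of "Gam (tval \<phi> v) \<phi>"] assms(4)
    by (simp add: dm_simps)
qed (use assms in \<open>auto intro: crisp_Gam split: if_splits\<close>)

end

section \<open>Simultaneous substitution\<close>

text \<open>
  The substitutions are nested so that the first pair of the list is the outermost, as in the
  axiom that reduces atomic formulas to the variables \<open>v\<^sub>0, v\<^sub>1, \<dots>\<close>.
\<close>

definition substs :: "(nat \<times> nat) list \<Rightarrow> ('m, 'i) fm \<Rightarrow> ('m, 'i) fm" where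
  "substs \<rho> \<phi> = foldr (\<lambda>(k, l). Subst k l) \<rho> \<phi>"

lemma substs_simps [simp]:
  "substs [] \<phi> = \<phi>"
  "substs ((k, l) # \<rho>) \<phi> = Subst k l (substs \<rho> \<phi>)"
  by (simp_all add: substs_def)

lemma formula_substs [simp]: "is_formula ar (substs \<rho> \<phi>) \<longleftrightarrow> is_formula ar \<phi>"
  by (induction \<rho>) auto

lemma Fv_substs: "Fv (substs \<rho> \<phi>) \<subseteq> (Fv \<phi> - fst ` set \<rho>) \<union> snd ` set \<rho>"
proof (induction \<rho>)
  case (Cons kl \<rho>)
  obtain k l where "kl = (k, l)" by force
  with Cons show ?case by simp blast
qed simp

context
  fixes ar :: "'i \<Rightarrow> nat" and \<Sigma> :: "('m::{finite,de_morgan_algebra}, 'i) fm set"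
begin

lemma crisp_substs: "crisp ar \<Sigma> \<chi> \<Longrightarrow> crisp ar \<Sigma> (substs \<rho> \<chi>)"
  by (induction \<rho>) (auto intro: crisp_Subst)

lemma substs_at_eq:
  assumes "v \<in> points ar \<Sigma>" "is_formula ar \<phi>"
  shows "(\<And>k l. (k, l) \<in> set \<rho> \<Longrightarrow> k \<noteq> l \<and> tval (k \<^bold>\<approx> l) v = 1) \<Longrightarrow>
    tval (substs \<rho> \<phi>) v = tval \<phi> v"
proof (induction \<rho>)
  case (Cons kl \<rho>)
  obtain k l where kl: "kl = (k, l)" by force
  show ?case using Cons assms Subst_at_eq[OF assms(1), of k l "substs \<rho> \<phi>"] unfolding kl by auto
qed simp

lemma Subst_Exi:
  assumes "v \<in> points ar \<Sigma>" "is_formula ar \<phi>" "k \<notin> {j, l}"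
  shows "tval (Subst j l (Exi k \<phi>)) v = tval (Exi k (Subst j l \<phi>)) v"
proof -
  have "tval (j \<^bold>\<approx> l \<^bold>\<and> Exi k \<phi>) u = tval (Exi k (j \<^bold>\<approx> l \<^bold>\<and> \<phi>)) u" if u: "u \<in> points ar \<Sigma>" for u
  proof -
    have "tval (Exi k (j \<^bold>\<approx> l \<^bold>\<and> \<phi>)) u = tval (Exi k (\<phi> \<^bold>\<and> (j \<^bold>\<approx> l))) u"
      using assms u by (intro exists_cong[of ar \<Sigma>]) (auto simp: mult.commute)
    then show ?thesis
      using exists_conj[of k "j \<^bold>\<approx> l" ar \<phi> u \<Sigma>] assms u by (simp add: mult.commute)
  qed
  then have "tval (Subst j l (Exi k \<phi>)) v = tval (Exi j (Exi k (j \<^bold>\<approx> l \<^bold>\<and> \<phi>))) v"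
    unfolding Subst_def using assms by (intro exists_cong[of ar \<Sigma>]) auto
  then show ?thesis
    unfolding Subst_def using exists_commute[of ar "j \<^bold>\<approx> l \<^bold>\<and> \<phi>" v \<Sigma>] assms by simp
qed

lemma substs_Exi:
  assumes "is_formula ar \<phi>"
  shows "k \<notin> fst ` set \<rho> \<union> snd ` set \<rho> \<Longrightarrow> v \<in> points ar \<Sigma> \<Longrightarrow>
    tval (substs \<rho> (Exi k \<phi>)) v = tval (Exi k (substs \<rho> \<phi>)) v"
proof (induction \<rho> arbitrary: v)
  case (Cons jl \<rho>)
  obtain j l where jl: "jl = (j, l)" by force
  have "tval (substs (jl # \<rho>) (Exi k \<phi>)) v = tval (Subst j l (Exi k (substs \<rho> \<phi>))) v"
    unfolding jl substs_simps using Cons assms by (intro Subst_cong[of ar \<Sigma>]) auto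
  then show ?case
    using Subst_Exi[of v "substs \<rho> \<phi>" k j l] Cons.prems assms jl by simp
qed simp

text \<open>
  The variables in the domain of \<open>\<rho>\<close> can be reassigned to the elements named by the variables in
  its range; formulas without free variables in the domain keep their values. Together with
  \<open>substs_at_eq\<close> this determines the new point: the value of \<open>\<phi>\<close> there is that of \<open>substs \<rho> \<phi>\<close>, both
  at the new and at the old point.
\<close>

lemma reassign_point:
  assumes "v \<in> points ar \<Sigma>"
  shows "distinct (map fst \<rho>) \<Longrightarrow> fst ` set \<rho> \<inter> snd ` set \<rho> = {} \<Longrightarrow>
    \<exists>u\<in>points ar \<Sigma>. (\<forall>(k, l)\<in>set \<rho>. tval (k \<^bold>\<approx> l) u = 1) \<and>
      (\<forall>\<psi>. is_formula ar \<psi> \<longrightarrow> Fv \<psi> \<inter> fst ` set \<rho> = {} \<longrightarrow> tval \<psi> u = tval \<psi> v)"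
proof (induction \<rho>)
  case Nil
  then show ?case using assms by auto
next
  case (Cons kl \<rho>)
  obtain k l where kl: "kl = (k, l)" by force
  have "distinct (map fst \<rho>)" "fst ` set \<rho> \<inter> snd ` set \<rho> = {}"
    using Cons.prems by auto
  with Cons.IH obtain u where u: "u \<in> points ar \<Sigma>" "\<forall>(k, l)\<in>set \<rho>. tval (k \<^bold>\<approx> l) u = 1"
    "\<forall>\<psi>. is_formula ar \<psi> \<longrightarrow> Fv \<psi> \<inter> fst ` set \<rho> = {} \<longrightarrow> tval \<psi> u = tval \<psi> v"
    by auto
  have ne: "k \<noteq> l" and k: "k \<notin> fst ` set \<rho>" "k \<notin> snd ` set \<rho>"
    using Cons.prems kl by auto
  let ?w = "shift k l u"
  have "tval (k' \<^bold>\<approx> l') ?w = 1" if "(k', l') \<in> set \<rho>" for k' l'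
  proof -
    have "k \<noteq> k'" "k \<noteq> l'" using that k by force+
    then show ?thesis using shift_free[OF u(1) ne, of "k' \<^bold>\<approx> l'"] u(2) that by auto
  qed
  moreover have "tval \<psi> ?w = tval \<psi> v"
    if "is_formula ar \<psi>" "Fv \<psi> \<inter> fst ` set (kl # \<rho>) = {}" for \<psi>
    using shift_free[OF u(1) ne, of \<psi>] u(3) that kl by auto
  ultimately show ?case
    using shift_point[OF u(1) ne] shift_eq[OF u(1) ne] kl by (intro bexI[of _ ?w]) auto
qed

text \<open>
  The axiom for atomic formulas expresses \<open>R\<^sub>i\<close> applied to any arguments by substitution in one
  formula \<open>\<chi>\<close> in fresh variables \<open>ks\<close>. At a point where the \<open>ks\<close> are reassigned to the elements named by
  \<open>js\<close>, and therefore also to those named by \<open>js'\<close>, both atomic formulas have the value of \<open>\<chi>\<close>.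
\<close>

lemma Rel_cong:
  assumes v: "v \<in> points ar \<Sigma>" and len: "length js = ar i" "length js' = ar i"
    and eq: "\<And>m. m < ar i \<Longrightarrow> tval (js ! m \<^bold>\<approx> js' ! m) v = 1"
  shows "tval (Rel i js) v = tval (Rel i js') v"
proof -
  obtain B where B: "\<forall>x\<in>{0..<ar i} \<union> set js \<union> set js'. x < B"
    using finite_nat_set_iff_bounded[of "{0..<ar i} \<union> set js \<union> set js'"] by auto
  define ks where "ks = [B..<B + ar i]"
  define \<chi> where "\<chi> = substs (zip [0..<ar i] ks) (Rel i [0..<ar i] :: ('m, 'i) fm)"
  have "x \<notin> set ks" if "x \<in> {0..<ar i} \<union> set js \<union> set js'" for x
    using bspec[OF B that] by (simp add: ks_def)
  then have ks: "length ks = ar i" "distinct ks" "set ks \<inter> ({0..<ar i} \<union> set js \<union> set js') = {}"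
    by (simp add: ks_def, simp add: ks_def, blast)
  have f: "is_formula ar \<chi>" by (simp add: \<chi>_def)
  have zip: "fst ` set (zip ks js) = set ks" "snd ` set (zip ks js) = set js"
    using ks len by (metis list.set_map map_fst_zip, metis list.set_map map_snd_zip)
  have "distinct (map fst (zip ks js))" "set ks \<inter> set js = {}" using ks len by auto
  then obtain u where u: "u \<in> points ar \<Sigma>" "\<forall>(k, l)\<in>set (zip ks js). tval (k \<^bold>\<approx> l) u = 1"
    "\<And>\<psi>. is_formula ar \<psi> \<Longrightarrow> Fv \<psi> \<inter> set ks = {} \<Longrightarrow> tval \<psi> u = tval \<psi> v"
    using reassign_point[OF v, of "zip ks js"] unfolding zip by blast
  have ksjs: "tval (ks ! m \<^bold>\<approx> js ! m) u = 1" if "m < ar i" for m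
    using u(2) that ks len by (auto simp: set_zip)
  have ksjs': "tval (ks ! m \<^bold>\<approx> js' ! m) u = 1" if m: "m < ar i" for m
  proof -
    have "Fv (js ! m \<^bold>\<approx> js' ! m) \<inter> set ks = {}"
      using ks len m by (auto dest: nth_mem)
    then have "tval (js ! m \<^bold>\<approx> js' ! m) u = 1"
      using u(3)[of "js ! m \<^bold>\<approx> js' ! m"] eq[OF m] by simp
    with ksjs[OF m] show ?thesis by (rule equal_trans[OF u(1)])
  qed
  have key: "tval (Rel i xs) v = tval \<chi> u"
    if xs: "length xs = ar i" "set ks \<inter> ({0..<ar i} \<union> set xs) = {}"
      "\<And>m. m < ar i \<Longrightarrow> tval (ks ! m \<^bold>\<approx> xs ! m) u = 1" for xs
  proof -
    have "Fv (Rel i xs) \<inter> set ks = {}" using xs(2) by auto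
    then have "tval (Rel i xs) v = tval (Rel i xs) u"
      using u(3)[of "Rel i xs"] xs(1) by simp
    also have "\<dots> = tval (substs (zip ks xs) \<chi>) u"
      unfolding \<chi>_def substs_def
    proof (rule point_Same[OF u(1)])
      show "is_axiom ar (Rel i xs \<^bold>\<Leftrightarrow> foldr (\<lambda>(k, j). Subst k j) (zip ks xs)
        (foldr (\<lambda>(m, k). Subst m k) (zip [0..<ar i] ks) (Rel i [0..<ar i])))"
        using xs ks by (intro ax14) auto
    qed (use xs f in \<open>simp_all flip: substs_def\<close>)
    also have "\<dots> = tval \<chi> u"
    proof (rule substs_at_eq[OF u(1) f])
      fix k l assume "(k, l) \<in> set (zip ks xs)"
      then obtain m where m: "m < ar i" "k = ks ! m" "l = xs ! m"
        using ks xs by (auto simp: set_zip)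
      then have "k \<in> set ks" "l \<in> set xs" using xs(1) ks(1) by simp_all
      then have "k \<noteq> l" using xs(2) by blast
      then show "k \<noteq> l \<and> tval (k \<^bold>\<approx> l) u = 1" using xs(3) m by simp
    qed
    finally show ?thesis .
  qed
  show ?thesis
    using key[of js] key[of js'] ks len ksjs ksjs' by (simp add: Int_Un_distrib)
qed

section \<open>Henkin points\<close>

text \<open>
  The axiom for \<open>\<gamma>\<^sub>p \<exists>v\<^sub>k \<phi>\<close>, read at a point, is the semantic clause of \<open>\<exists>\<close> with \<open>W\<close> in the place of the
  set of attained values.
\<close>

lemma exists_value:
  assumes v: "v \<in> points ar \<Sigma>" and f: "is_formula ar \<phi>"
  shows "tval (Exi k \<phi>) v = \<Sum>{q. tval (Exi k (Gam q \<phi>)) v = 1}"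
proof -
  define p where "p = tval (Exi k \<phi>) v"
  define W where "W = {q. tval (Exi k (Gam q \<phi>)) v = 1}"
  have crisp: "tval (Exi k (Gam q \<phi>)) v = 0 \<or> tval (Exi k (Gam q \<phi>)) v = 1" for q
    by (intro crispD[OF _ v] crisp_Exi crisp_Gam f)
  have all: "tval (BigAnd A (\<lambda>q. Exi k (Gam q \<phi>))) v = (if A \<subseteq> W then 1 else 0)" for A
    using crisp by (subst tval_BigAnd) (auto simp: W_def)
  have ex: "tval (BigOr \<A> (\<lambda>A. BigAnd A (\<lambda>q. Exi k (Gam q \<phi>)))) v =
      (if \<exists>A\<in>\<A>. A \<subseteq> W then 1 else 0)" for \<A>
    by (subst tval_BigOr) (auto simp: all)
  let ?eq = "{A. A \<noteq> {} \<and> \<Sum>A = p}" and ?gt = "{A. A \<noteq> {} \<and> \<Sum>A > p}"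
  have "tval (Gam p (Exi k \<phi>)) v =
    tval (BigOr ?eq (\<lambda>A. BigAnd A (\<lambda>q. Exi k (Gam q \<phi>))) \<^bold>\<and>
      (\<^bold>\<not> (BigOr ?gt (\<lambda>A. BigAnd A (\<lambda>q. Exi k (Gam q \<phi>)))))) v"
    using f by (intro point_Same[OF v ax13]) (auto simp: formula_BigOr formula_BigAnd)
  then have val: "tval (BigOr ?eq (\<lambda>A. BigAnd A (\<lambda>q. Exi k (Gam q \<phi>)))) v *
      - tval (BigOr ?gt (\<lambda>A. BigAnd A (\<lambda>q. Exi k (Gam q \<phi>)))) v = 1"
    by (simp add: p_def)
  have two: "a \<and> \<not> b" if "(if a then 1 else 0) * - (if b then 1 else 0) = (1 :: 'm)" for a b
    using that by (simp add: dm_simps split: if_splits)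
  have eq: "\<exists>A\<in>?eq. A \<subseteq> W" and gt: "\<not> (\<exists>A\<in>?gt. A \<subseteq> W)"
    using two[OF val[unfolded ex]] by (rule conjunct1, rule conjunct2)
  from eq obtain A where A: "A \<noteq> {}" "\<Sum>A = p" "A \<subseteq> W"
    by (elim bexE CollectE conjE)
  have "W \<noteq> {}" using A by blast
  then have max: "\<not> \<Sum>W > p" using gt by blast
  from sum_mono_set[OF A(3)] A(2) max have "\<Sum>W = p" by (simp add: order_less_le)
  then show ?thesis by (simp add: p_def W_def)
qed

lemma equal_commute:
  assumes "v \<in> points ar \<Sigma>"
  shows "tval (k \<^bold>\<approx> l) v = tval (l \<^bold>\<approx> k) v"
  using equal_sym[OF assms] crispD[OF crisp_Eq assms] by metis

text \<open>
  If \<open>v\<^sub>l\<close> is fresh then quantifying over it undoes the substitution, as the two quantifiers commute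
  and every element is named by some value of \<open>v\<^sub>l\<close>.
\<close>

lemma exists_Subst_fresh:
  assumes "v \<in> points ar \<Sigma>" "is_formula ar \<chi>" "k \<noteq> l" "l \<notin> Fv \<chi>"
  shows "tval (Exi l (Subst k l \<chi>)) v = tval (Exi k \<chi>) v"
proof -
  have "tval (Exi l (k \<^bold>\<approx> l \<^bold>\<and> \<chi>)) u = tval \<chi> u" if u: "u \<in> points ar \<Sigma>" for u
  proof -
    have "tval (Exi l (k \<^bold>\<approx> l \<^bold>\<and> \<chi>)) u = tval (Exi l (l \<^bold>\<approx> k \<^bold>\<and> \<chi>)) u"
      using assms u equal_commute by (intro exists_cong[of ar \<Sigma>]) auto
    then show ?thesis
      using exists_conj[of l \<chi> ar "l \<^bold>\<approx> k" u \<Sigma>] exists_eq[OF u, of l k] assms u by simp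
  qed
  then have "tval (Exi k (Exi l (k \<^bold>\<approx> l \<^bold>\<and> \<chi>))) v = tval (Exi k \<chi>) v"
    using assms by (intro exists_cong[of ar \<Sigma>]) auto
  then show ?thesis
    unfolding Subst_def using exists_commute[of ar "k \<^bold>\<approx> l \<^bold>\<and> \<chi>" v \<Sigma>] assms by simp
qed

text \<open>
  Each new witness is consistent with the earlier ones: if at all points with the earlier
  witnesses \<open>\<exists>v\<^sub>k \<chi>\<close> held and \<open>S\<^sup>k\<^sub>l \<chi>\<close> failed, with \<open>v\<^sub>l\<close> fresh, then \<open>S\<^sup>k\<^sub>l \<chi>\<close> would lie below the negation of
  the conjunction \<open>H\<close> of the earlier requirements. Then so would \<open>\<exists>v\<^sub>l S\<^sup>k\<^sub>l \<chi>\<close>, which is \<open>\<exists>v\<^sub>k \<chi>\<close>,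
  and both \<open>H\<close> and \<open>\<exists>v\<^sub>k \<chi>\<close> could not hold at one point.
\<close>

lemma finitely_many_witnesses:
  fixes ks L :: "nat \<Rightarrow> nat"
  assumes "points ar \<Sigma> \<noteq> {}" and crisp: "\<And>n. crisp ar \<Sigma> (\<chi> n)"
    and L: "\<And>n. L n \<noteq> ks n" "inj L" "\<And>i n. i \<le> n \<Longrightarrow> L n \<notin> Fv (\<chi> i)"
  shows "\<exists>v\<in>points ar \<Sigma>. \<forall>i<n.
    tval ((\<^bold>\<not> (Exi (ks i) (\<chi> i))) \<^bold>\<or> Subst (ks i) (L i) (\<chi> i)) v = 1"
proof (induction n)
  case 0
  then show ?case using assms(1) by auto
next
  case (Suc n)
  define h where "h i = ((\<^bold>\<not> (Exi (ks i) (\<chi> i))) \<^bold>\<or> Subst (ks i) (L i) (\<chi> i))" for i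
  have h: "crisp ar \<Sigma> (h i)" for i
    unfolding h_def by (intro crisp_Or crisp_Neg crisp_Exi crisp_Subst crisp)
  define H where "H = and_list (map h [0..<n])"
  have H: "tval H u = (if \<forall>i<n. tval (h i) u = 1 then 1 else 0)" if "u \<in> points ar \<Sigma>" for u
    unfolding H_def using crispD[OF h that] by (subst tval_and_list) auto
  have fH: "is_formula ar H"
    using h by (auto simp: H_def formula_and_list crisp_def)
  have "L n \<notin> Fv (h i)" if "i < n" for i
    using L(3)[of i n] inj_eq[OF L(2), of n i] that by (auto simp: h_def)
  then have fresh: "L n \<notin> Fv H" by (auto simp: H_def Fv_and_list)
  note f = crisp_formula[OF crisp]
  show ?case
  proof (rule ccontr)
    assume "\<not> ?thesis"
    then have no: "\<exists>i<Suc n. tval (h i) u \<noteq> 1" if "u \<in> points ar \<Sigma>" for u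
      using that by (auto simp: h_def)
    from Suc obtain v where v: "v \<in> points ar \<Sigma>" "\<forall>i<n. tval (h i) v = 1"
      by (auto simp: h_def)
    have "tval (Exi (L n) (Subst (ks n) (L n) (\<chi> n))) v \<le> tval (\<^bold>\<not> H) v"
    proof (rule exists_le[of ar \<Sigma>])
      fix u assume u: "u \<in> points ar \<Sigma>"
      show "tval (Subst (ks n) (L n) (\<chi> n)) u \<le> tval (\<^bold>\<not> H) u"
      proof (cases "\<forall>i<n. tval (h i) u = 1")
        case True
        then have "tval (h n) u \<noteq> 1" using no[OF u] by (auto simp: less_Suc_eq)
        then have "tval (Subst (ks n) (L n) (\<chi> n)) u = 0"
          using crispD[OF crisp_Subst[OF crisp] u, of "ks n" "L n" n] by (auto simp: h_def dm_simps)
        then show ?thesis by (simp add: dm_simps)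
      next
        case False
        then have "tval H u = 0" by (auto simp: H[OF u])
        then show ?thesis by (simp add: dm_simps)
      qed
    qed (use fresh fH f v in auto)
    also have "tval (\<^bold>\<not> H) v = 0" using v by (simp add: H dm_simps)
    finally have "tval (Exi (ks n) (\<chi> n)) v = 0"
      using exists_Subst_fresh[OF v(1) f L(1)[symmetric] L(3)[OF order.refl]] by (simp add: dm_simps)
    then have "tval (h n) v = 1" by (simp add: h_def dm_simps)
    then show False using no[OF v(1)] v(2) by (auto simp: less_Suc_eq)
  qed
qed

lemma henkin_point:
  assumes "points ar \<Sigma> \<noteq> {}" and "countable K"
    and crisp: "\<And>k \<chi>. (k, \<chi>) \<in> K \<Longrightarrow> crisp ar \<Sigma> \<chi>"
  shows "\<exists>v\<in>points ar \<Sigma>. \<forall>(k, \<chi>)\<in>K. tval (Exi k \<chi>) v = 1 \<longrightarrow>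
    (\<exists>l\<ge>N. tval (Subst k l \<chi>) v = 1)"
proof (cases "K = {}")
  case True
  then show ?thesis using assms(1) by auto
next
  case False
  define ks where "ks n = fst (from_nat_into K n)" for n
  define \<chi> where "\<chi> n = snd (from_nat_into K n)" for n
  have K: "(ks n, \<chi> n) \<in> K" for n
    using from_nat_into[OF False, of n] by (simp add: ks_def \<chi>_def)
  have enum: "\<exists>n. k = ks n \<and> \<psi> = \<chi> n" if "(k, \<psi>) \<in> K" for k \<psi>
    using that from_nat_into_surj[OF assms(2) that] by (auto simp: ks_def \<chi>_def) (metis fst_conv snd_conv)
  define b where "b n = Suc (Max (insert (ks n) (Fv (\<chi> n))))" for n
  have b: "x < b n" if "x = ks n \<or> x \<in> Fv (\<chi> n)" for x n
    unfolding b_def less_Suc_eq_le using that finite_Fv by (intro Max_ge) auto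
  \<comment> \<open>The witness of the \<open>n\<close>-th formula; it lies beyond the free variables of the formulas up
    to this one and beyond the earlier witnesses.\<close>
  define L where "L n = N + (\<Sum>i\<le>n. b i)" for n
  have bL: "b i \<le> L n" if "i \<le> n" for i n
    unfolding L_def using that member_le_sum[of i "{..n}" b] by simp
  have "strict_mono L"
    unfolding strict_mono_Suc_iff by (auto simp: L_def b_def)
  then have inj: "inj L" by (rule strict_mono_imp_inj_on)
  have fresh: "L n \<notin> Fv (\<chi> i)" if "i \<le> n" for i n
    using b[of "L n" i] bL[OF that] by auto
  have ne: "L n \<noteq> ks n" for n
    using b[of "L n" n] bL[of n n] by auto
  define h where "h i = ((\<^bold>\<not> (Exi (ks i) (\<chi> i))) \<^bold>\<or> Subst (ks i) (L i) (\<chi> i))" for i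
  have "\<exists>v\<in>points ar \<Sigma>. \<forall>\<phi>\<in>range h. tval \<phi> v = 1"
  proof (rule points_extension)
    fix D assume "finite D" "D \<subseteq> range h"
    then obtain J where J: "finite J" "D = h ` J" by (meson finite_subset_image)
    obtain n where n: "\<forall>i\<in>J. i < n" using J(1) finite_nat_set_iff_bounded by auto
    have "\<exists>v\<in>points ar \<Sigma>. \<forall>i<n. tval (h i) v = 1"
      unfolding h_def by (rule finitely_many_witnesses[OF assms(1) crisp[OF K] ne inj fresh])
    then show "\<exists>v\<in>points ar \<Sigma>. \<forall>\<phi>\<in>D. tval \<phi> v = 1"
      using n unfolding J(2) by blast
  qed
  then obtain v where v: "v \<in> points ar \<Sigma>" "\<And>i. tval (h i) v = 1" by auto
  have "\<exists>l\<ge>N. tval (Subst (ks i) l (\<chi> i)) v = 1" if "tval (Exi (ks i) (\<chi> i)) v = 1" for i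
    using v(2)[of i] that by (intro exI[of _ "L i"]) (auto simp: h_def dm_simps L_def)
  then show ?thesis using v(1) enum by blast
qed

end

section \<open>The structure of a Henkin point\<close>

primrec subformulas :: "('m, 'i) fm \<Rightarrow> ('m, 'i) fm set" where
  "subformulas (Rel i ks) = {Rel i ks}"
| "subformulas (j \<^bold>\<approx> k) = {j \<^bold>\<approx> k}"
| "subformulas (Val p) = {Val p}"
| "subformulas (\<^bold>\<not> \<phi>) = insert (\<^bold>\<not> \<phi>) (subformulas \<phi>)"
| "subformulas (\<phi> \<^bold>\<and> \<theta>) = insert (\<phi> \<^bold>\<and> \<theta>) (subformulas \<phi> \<union> subformulas \<theta>)"
| "subformulas (\<phi> \<^bold>\<or> \<theta>) = insert (\<phi> \<^bold>\<or> \<theta>) (subformulas \<phi> \<union> subformulas \<theta>)"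
| "subformulas (Exi k \<phi>) = insert (Exi k \<phi>) (subformulas \<phi>)"
| "subformulas (Gam p \<phi>) = insert (Gam p \<phi>) (subformulas \<phi>)"

primrec vars :: "('m, 'i) fm \<Rightarrow> nat set" where
  "vars (Rel i ks) = set ks"
| "vars (j \<^bold>\<approx> k) = {j, k}"
| "vars (Val p) = {}"
| "vars (\<^bold>\<not> \<phi>) = vars \<phi>"
| "vars (\<phi> \<^bold>\<and> \<theta>) = vars \<phi> \<union> vars \<theta>"
| "vars (\<phi> \<^bold>\<or> \<theta>) = vars \<phi> \<union> vars \<theta>"
| "vars (Exi k \<phi>) = insert k (vars \<phi>)"
| "vars (Gam p \<phi>) = vars \<phi>"

lemma subformulas_self: "\<phi> \<in> subformulas \<phi>"
  by (cases \<phi>) auto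

lemma finite_subformulas: "finite (subformulas \<phi>)"
  by (induction \<phi>) auto

lemma formula_subformulas: "is_formula ar \<phi> \<Longrightarrow> \<psi> \<in> subformulas \<phi> \<Longrightarrow> is_formula ar \<psi>"
  by (induction \<phi>) auto

lemma finite_vars: "finite (vars \<phi>)"
  by (induction \<phi>) auto

lemma Fv_vars: "Fv \<phi> \<subseteq> vars \<phi>"
  by (induction \<phi>) auto

text \<open>
  The element \<open>a\<close> of the structure stands for the variable of index \<open>N + a\<close>, so that the universe is a
  whole type and the variables below \<open>N\<close> remain available as variables of the formulas to be interpreted.
\<close>

definition henkin_eq :: "nat \<Rightarrow> (('m::de_morgan_algebra, 'i) fm \<Rightarrow> 'm) \<Rightarrow> nat \<Rightarrow> nat \<Rightarrow> bool" where
  "henkin_eq N v a b \<longleftrightarrow> tval ((N + a) \<^bold>\<approx> (N + b)) v = 1"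

definition henkin_rel :: "nat \<Rightarrow> (('m::de_morgan_algebra, 'i) fm \<Rightarrow> 'm) \<Rightarrow> 'i \<Rightarrow> nat list \<Rightarrow> 'm" where
  "henkin_rel N v i xs = tval (Rel i (map ((+) N) xs)) v"

context
  fixes ar :: "'i \<Rightarrow> nat" and \<Sigma> :: "('m::{finite,de_morgan_algebra}, 'i) fm set"
begin

lemma henkin_congruence:
  assumes v: "v \<in> points ar \<Sigma>"
  shows "congruence ar (henkin_eq N v) (henkin_rel N v)"
  unfolding congruence_def
proof (intro conjI allI impI)
  show "equivp (henkin_eq N v)"
    by (rule equivpI)
       (auto simp: henkin_eq_def reflp_def symp_def transp_def
         intro: equal_refl[OF v] equal_sym[OF v] equal_trans[OF v])
  fix i and xs ys :: "nat list"
  assume "length xs = ar i" "list_all2 (henkin_eq N v) xs ys"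
  then show "henkin_rel N v i xs = henkin_rel N v i ys"
    unfolding henkin_rel_def
    by (intro Rel_cong[OF v]) (auto simp: list_all2_conv_all_nth henkin_eq_def)
qed

text \<open>
  The points at which the variables below \<open>N\<close> are assigned the elements \<open>s 0, s 1, \<dots>\<close> of the
  structure given by \<open>v\<close>.
\<close>

definition realizes :: "nat \<Rightarrow> (('m, 'i) fm \<Rightarrow> 'm) \<Rightarrow> (nat \<Rightarrow> nat) \<Rightarrow> (('m, 'i) fm \<Rightarrow> 'm) \<Rightarrow> bool" where
  "realizes N v s w \<longleftrightarrow> w \<in> points ar \<Sigma> \<and> (\<forall>k<N. tval (k \<^bold>\<approx> (N + s k)) w = 1) \<and>
     (\<forall>\<psi>. is_formula ar \<psi> \<longrightarrow> Fv \<psi> \<inter> {..<N} = {} \<longrightarrow> tval \<psi> w = tval \<psi> v)"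

lemma realizes_exists:
  assumes v: "v \<in> points ar \<Sigma>"
  shows "\<exists>w. realizes N v s w"
proof -
  let ?\<rho> = "map (\<lambda>k. (k, N + s k)) [0..<N]"
  have fst: "fst ` set ?\<rho> = {..<N}" by (auto simp: image_image)
  have "map fst ?\<rho> = [0..<N]" by (simp add: comp_def)
  then have "distinct (map fst ?\<rho>)" by (metis distinct_upt)
  moreover have "fst ` set ?\<rho> \<inter> snd ` set ?\<rho> = {}" by auto
  ultimately obtain u where "u \<in> points ar \<Sigma>" "\<forall>(k, l)\<in>set ?\<rho>. tval (k \<^bold>\<approx> l) u = 1"
    "\<forall>\<psi>. is_formula ar \<psi> \<longrightarrow> Fv \<psi> \<inter> {..<N} = {} \<longrightarrow> tval \<psi> u = tval \<psi> v"
    using reassign_point[OF v, of ?\<rho>] unfolding fst by blast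
  then have "realizes N v s u" by (auto simp: realizes_def)
  then show ?thesis by blast
qed

text \<open>
  In the quantifier step, let \<open>\<rho>\<close> substitute the values of all variables below \<open>N\<close> except \<open>v\<^sub>k\<close>. The
  formula \<open>substs \<rho> (\<exists>v\<^sub>k \<gamma>\<^sub>q \<phi>)\<close> has no free variable below \<open>N\<close>; hence its value at \<open>v\<close> is the value
  of \<open>\<exists>v\<^sub>k \<gamma>\<^sub>q \<phi>\<close> at all points that realize some \<open>s(k := x)\<close>. If that value is \<open>1\<close> then the witness
  at \<open>v\<close> gives an element \<open>x\<close> at which \<open>\<phi>\<close> has the value \<open>q\<close>. Conversely, if \<open>\<phi>\<close> has the value \<open>q\<close> at some
  \<open>x\<close>, then \<open>\<exists>v\<^sub>k \<gamma>\<^sub>q \<phi>\<close> holds at the points realizing \<open>s(k := x)\<close>. The two sets of values thus agree,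
  and \<open>exists_value\<close> applies.
\<close>

lemma henkin_truth:
  assumes v: "v \<in> points ar \<Sigma>"
    and henkin: "\<And>k \<phi> \<rho> q. \<phi> \<in> F \<Longrightarrow> tval (Exi k (substs \<rho> (Gam q \<phi>))) v = 1 \<Longrightarrow>
      \<exists>l\<ge>N. tval (Subst k l (substs \<rho> (Gam q \<phi>))) v = 1"
  shows "is_formula ar \<phi> \<Longrightarrow> vars \<phi> \<subseteq> {..<N} \<Longrightarrow> subformulas \<phi> \<subseteq> F \<Longrightarrow> realizes N v s w \<Longrightarrow>
    tval \<phi> w = pval (henkin_eq N v) (henkin_rel N v) \<phi> s"
proof (induction \<phi> arbitrary: s w)
  case (Rel i ks)
  then have w: "w \<in> points ar \<Sigma>" by (simp add: realizes_def)
  have "tval (Rel i ks) w = tval (Rel i (map (\<lambda>k. N + s k) ks)) w"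
  proof (rule Rel_cong[OF w])
    fix m assume "m < ar i"
    then have "ks ! m \<in> set ks" using Rel.prems(1) by simp
    from subsetD[OF Rel.prems(2)[unfolded vars.simps] this]
    have "ks ! m < N" "m < length ks" using Rel.prems(1) \<open>m < ar i\<close> by simp_all
    then show "tval (ks ! m \<^bold>\<approx> map (\<lambda>k. N + s k) ks ! m) w = 1"
      using Rel by (simp add: realizes_def)
  qed (use Rel in auto)
  also have "\<dots> = tval (Rel i (map (\<lambda>k. N + s k) ks)) v"
  proof -
    have "Fv (Rel i (map (\<lambda>k. N + s k) ks) :: ('m, 'i) fm) \<inter> {..<N} = {}" by auto
    then show ?thesis using Rel unfolding realizes_def by (metis is_formula.simps(1) length_map)
  qed
  finally show ?case by (simp add: henkin_rel_def comp_def)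
next
  case (Eq j k)
  then have w: "w \<in> points ar \<Sigma>" and jk: "j < N" "k < N"
    and e: "tval (j \<^bold>\<approx> (N + s j)) w = 1" "tval (k \<^bold>\<approx> (N + s k)) w = 1"
    by (auto simp: realizes_def)
  have "tval (j \<^bold>\<approx> k) w = 1 \<longleftrightarrow> tval ((N + s j) \<^bold>\<approx> (N + s k)) w = 1"
    using equal_trans[OF w] equal_sym[OF w] e by metis
  also have "tval ((N + s j) \<^bold>\<approx> (N + s k)) w = tval ((N + s j) \<^bold>\<approx> (N + s k)) v"
  proof -
    have "Fv ((N + s j) \<^bold>\<approx> (N + s k) :: ('m, 'i) fm) \<inter> {..<N} = {}" by auto
    then show ?thesis using Eq unfolding realizes_def by (metis is_formula.simps(2))
  qed
  finally show ?case
    using crispD[OF crisp_Eq w, of j k] by (auto simp: henkin_eq_def)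
next
  case (Exi k \<phi>)
  have w: "w \<in> points ar \<Sigma>" using Exi by (simp add: realizes_def)
  have k: "k < N" and f: "is_formula ar \<phi>" and \<phi>: "\<phi> \<in> F" "Fv \<phi> \<subseteq> {..<N}"
    using Exi.prems subformulas_self[of \<phi>] Fv_vars[of \<phi>] by auto
  let ?val = "\<lambda>x. pval (henkin_eq N v) (henkin_rel N v) \<phi> (s(k := x))"
  define \<rho> where "\<rho> = map (\<lambda>j. (j, N + s j)) (filter (\<lambda>j. j \<noteq> k) [0..<N])"
  have \<rho>: "fst ` set \<rho> = {..<N} - {k}" "snd ` set \<rho> \<subseteq> {N..}"
    by (auto simp: \<rho>_def image_image)
  have IH: "tval \<phi> w' = ?val x" if "realizes N v (s(k := x)) w'" for x w'
    using Exi.prems by (intro Exi.IH that) auto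
  have at: "tval (substs \<rho> \<psi>) w' = tval \<psi> w'"
    if "realizes N v (s(k := x)) w'" "is_formula ar \<psi>" for x w' \<psi>
    using that by (intro substs_at_eq) (auto simp: realizes_def \<rho>_def)
  have real: "realizes N v (s(k := s k)) w" using Exi.prems by simp
  have agree: "tval (Exi k (Gam q \<phi>)) w' = tval (substs \<rho> (Exi k (Gam q \<phi>))) v"
    if "realizes N v (s(k := x)) w'" for x w' q
  proof -
    have "Fv (substs \<rho> (Exi k (Gam q \<phi>))) \<inter> {..<N} = {}"
      using Fv_substs[of \<rho> "Exi k (Gam q \<phi>)"] \<rho> \<phi>(2) by fastforce
    then show ?thesis using at[OF that, of "Exi k (Gam q \<phi>)"] that f by (simp add: realizes_def)
  qed
  have "{q. tval (Exi k (Gam q \<phi>)) w = 1} = {?val x | x. True}"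
  proof (intro equalityI subsetI)
    fix q assume "q \<in> {q. tval (Exi k (Gam q \<phi>)) w = 1}"
    then have "tval (substs \<rho> (Exi k (Gam q \<phi>))) v = 1" using agree[OF real] by simp
    then have "tval (Exi k (substs \<rho> (Gam q \<phi>))) v = 1"
    proof -
      have "k \<notin> fst ` set \<rho> \<union> snd ` set \<rho>" using \<rho> k by auto
      then show ?thesis
        using substs_Exi[of ar "Gam q \<phi>" k \<rho> v \<Sigma>] f v \<open>tval (substs \<rho> _) v = 1\<close> by simp
    qed
    from henkin[OF \<phi>(1) this] obtain l where
      l: "l \<ge> N" "tval (Subst k l (substs \<rho> (Gam q \<phi>))) v = 1" by blast
    define x where "x = l - N"
    have x: "l = N + x" using l by (simp add: x_def)
    obtain w' where w': "realizes N v (s(k := x)) w'" using realizes_exists[OF v] by blast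
    have p': "w' \<in> points ar \<Sigma>" "tval (k \<^bold>\<approx> l) w' = 1"
      using w' k by (auto simp: realizes_def x)
    have "Fv (Subst k l (substs \<rho> (Gam q \<phi>))) \<inter> {..<N} = {}"
      using Fv_substs[of \<rho> "Gam q \<phi>"] \<rho> \<phi>(2) l(1) by fastforce
    then have "1 = tval (Subst k l (substs \<rho> (Gam q \<phi>))) w'"
      using w' l(2) f unfolding realizes_def by simp
    also have "\<dots> = tval (substs \<rho> (Gam q \<phi>)) w'"
      using k l(1) f p' by (intro Subst_at_eq) auto
    also have "\<dots> = tval (Gam q \<phi>) w'" using f by (intro at[OF w']) simp
    finally have "?val x = q" using IH[OF w'] by (simp split: if_splits)
    then show "q \<in> {?val x | x. True}" by auto
  next
    fix q assume "q \<in> {?val x | x. True}"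
    then obtain x where q: "q = ?val x" by auto
    obtain w' where w': "realizes N v (s(k := x)) w'" using realizes_exists[OF v] by blast
    then have p': "w' \<in> points ar \<Sigma>" by (simp add: realizes_def)
    have "tval (Exi k (Gam q \<phi>)) w' = 1"
      using le_exists[OF p', of "Gam q \<phi>" k] f IH[OF w'] q by (simp add: dm_simps)
    then show "q \<in> {q. tval (Exi k (Gam q \<phi>)) w = 1}"
      using agree[OF w'] agree[OF real] by simp
  qed
  then show ?case using exists_value[OF w f, of k] by simp
qed auto

lemma finite_part_satisfiable:
  assumes "points ar \<Sigma> \<noteq> {}" "\<And>\<phi>. \<phi> \<in> \<Sigma> \<Longrightarrow> is_formula ar \<phi>" "finite D" "D \<subseteq> \<Sigma>"
  shows "\<exists>E (I :: 'i \<Rightarrow> nat list \<Rightarrow> 'm). congruence ar E I \<and> (\<forall>\<phi>\<in>D. \<forall>s. pval E I \<phi> s = 1)"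
proof -
  define F where "F = (\<Union>\<phi>\<in>D. subformulas \<phi>)"
  have F: "finite F" "\<And>\<phi>. \<phi> \<in> F \<Longrightarrow> is_formula ar \<phi>"
  proof -
    show "finite F" using assms(3) by (simp add: F_def finite_subformulas)
    fix \<phi> assume "\<phi> \<in> F"
    then obtain \<psi> where "\<psi> \<in> D" "\<phi> \<in> subformulas \<psi>" by (auto simp: F_def)
    then show "is_formula ar \<phi>" using assms(2,4) formula_subformulas by blast
  qed
  have "finite (\<Union>\<phi>\<in>D. vars \<phi>)" using assms(3) finite_vars by auto
  then obtain N where N: "\<And>\<phi>. \<phi> \<in> D \<Longrightarrow> vars \<phi> \<subseteq> {..<N}"
    using finite_nat_set_iff_bounded[of "\<Union>\<phi>\<in>D. vars \<phi>"] by auto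
  define K where "K = (\<lambda>(k, \<rho>, q, \<phi>). (k :: nat, substs \<rho> (Gam q \<phi>))) ` (UNIV \<times> UNIV \<times> UNIV \<times> F)"
  have "countable K"
    unfolding K_def using F(1) by (intro countable_image countable_SIGMA) (auto intro: countable_finite)
  moreover have "crisp ar \<Sigma> \<chi>" if "(k, \<chi>) \<in> K" for k \<chi>
    using that F(2) by (auto simp: K_def intro!: crisp_substs crisp_Gam)
  ultimately obtain v where v: "v \<in> points ar \<Sigma>"
    and henkin: "\<forall>(k, \<chi>)\<in>K. tval (Exi k \<chi>) v = 1 \<longrightarrow> (\<exists>l\<ge>N. tval (Subst k l \<chi>) v = 1)"
    using henkin_point[OF assms(1)] by blast
  have "pval (henkin_eq N v) (henkin_rel N v) \<phi> s = 1" if \<phi>: "\<phi> \<in> D" for \<phi> s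
  proof -
    obtain w where w: "realizes N v s w" using realizes_exists[OF v] by blast
    have f: "is_formula ar \<phi>" using assms \<phi> by auto
    have "tval \<phi> w = pval (henkin_eq N v) (henkin_rel N v) \<phi> s"
    proof (rule henkin_truth[OF v _ f N[OF \<phi>] _ w, of F])
      show "\<exists>l\<ge>N. tval (Subst k l (substs \<rho> (Gam q \<psi>))) v = 1"
        if "\<psi> \<in> F" "tval (Exi k (substs \<rho> (Gam q \<psi>))) v = 1" for k \<psi> \<rho> q
      proof -
        have "(k, substs \<rho> (Gam q \<psi>)) \<in> K" unfolding K_def using that(1) by force
        then show ?thesis using henkin that(2) by fastforce
      qed
      show "subformulas \<phi> \<subseteq> F" using \<phi> by (auto simp: F_def)
    qed
    moreover have "tval \<phi> w = 1"
      using w \<phi> assms derives_hyp[of \<phi> \<Sigma> ar] f by (auto simp: realizes_def points_def)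
    ultimately show ?thesis by simp
  qed
  then show ?thesis using henkin_congruence[OF v] by blast
qed

end

section \<open>Existence of models\<close>

text \<open>
  The structures for the finite parts of \<open>\<Sigma>\<close> are indexed by all sets of formulas, of which only
  the finite parts matter to the ultrafilter; the other indices receive some structure.
\<close>

lemma consistent_has_model:
  fixes \<Sigma> :: "('m::{finite,de_morgan_algebra}, 'i) fm set"
  assumes \<Sigma>: "\<And>\<phi>. \<phi> \<in> \<Sigma> \<Longrightarrow> is_formula ar \<phi>" and "consistent ar \<Sigma>"
  shows "\<exists>(U :: ('m, 'i) fm set) P. is_model ar U P \<Sigma>"
proof -
  have ne: "points ar \<Sigma> \<noteq> {}"
    using assms(2) derives_iff_points[of ar "Val 0" \<Sigma>] by (auto simp: consistent_def)
  have "\<exists>E (I :: 'i \<Rightarrow> nat list \<Rightarrow> 'm). congruence ar E I \<and>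
      (\<forall>\<phi>\<in>(if finite D \<and> D \<subseteq> \<Sigma> then D else {}). \<forall>s. pval E I \<phi> s = 1)" for D
    by (rule finite_part_satisfiable[OF ne \<Sigma>]) auto
  then obtain E :: "('m, 'i) fm set \<Rightarrow> nat \<Rightarrow> nat \<Rightarrow> bool" and I :: "('m, 'i) fm set \<Rightarrow> 'i \<Rightarrow> nat list \<Rightarrow> 'm"
    where cong: "\<And>D. congruence ar (E D) (I D)"
      and true: "\<And>D \<phi> s. \<phi> \<in> (if finite D \<and> D \<subseteq> \<Sigma> then D else {}) \<Longrightarrow> pval (E D) (I D) \<phi> s = 1"
    by metis
  from ultra_exists[OF finite_subsets_at_top_neq_bot] obtain G where
    GF: "G \<le> finite_subsets_at_top \<Sigma>" and G: "ultra G" by blast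
  have ev: "eventually (\<lambda>D. finite D \<and> D \<subseteq> \<Sigma> \<and> \<phi> \<in> D) G" if "\<phi> \<in> \<Sigma>" for \<phi>
  proof -
    have "eventually (\<lambda>D. finite D \<and> D \<subseteq> \<Sigma> \<and> \<phi> \<in> D) (finite_subsets_at_top \<Sigma>)"
      unfolding eventually_finite_subsets_at_top
      using that by (intro exI[of _ "{\<phi>}"]) auto
    then show ?thesis using GF by (simp add: le_filter_def)
  qed
  define E' where "E' f g \<longleftrightarrow> eventually (\<lambda>D. E D (f D) (g D)) G" for f g
  define I' where "I' i fs = ulim G (\<lambda>D. I D i (map (\<lambda>f. f D) fs))" for i fs
  have true': "pval E' I' \<phi> s = 1" if "\<phi> \<in> \<Sigma>" for \<phi> s
  proof -
    have "eventually (\<lambda>D. pval E' I' \<phi> s = 1) G"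
      using pval_ultraproduct[where E = E and I = I and E' = E' and I' = I', OF G E'_def I'_def, of \<phi> s] ev[OF that]
    proof eventually_elim
      case (elim D)
      then show ?case using true[of \<phi> D] by simp
    qed
    then show ?thesis using G by (simp add: ultra_def eventually_const_iff)
  qed
  show ?thesis
  proof -
    obtain E'' and I'' :: "'i \<Rightarrow> ('m, 'i) skolem list \<Rightarrow> 'm" where
      "congruence ar E'' I''" "\<And>\<phi> t. \<exists>s. pval E'' I'' \<phi> t = pval E' I' \<phi> s"
      using skolem_hull[OF congruence_ultraproduct[where E = E and I = I and E' = E' and I' = I', OF G cong E'_def I'_def]] by blast
      note hull = this
    have true'': "pval E'' I'' \<phi> t = 1" if "\<phi> \<in> \<Sigma>" for \<phi> t
      using hull(2)[of \<phi> t] true'[OF that] by auto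
    show ?thesis
      by (rule model_of_pval[OF hull(1) inj_skolem_code \<Sigma> true''])
  qed
qed

lemma sem_subset: "sem U P \<phi> p \<subseteq> seqs U"
proof (induction \<phi> arbitrary: p)
  case (Exi k \<phi>)
  have "(\<Inter>q\<in>A. cyl U k (sem U P \<phi> q)) \<subseteq> seqs U" if "A \<noteq> {}" for A
    using that by (auto simp: cyl_def)
  then have "(\<Union>A\<in>{A. A \<noteq> {} \<and> \<Sum>A = p}. \<Inter>q\<in>A. cyl U k (sem U P \<phi> q)) \<subseteq> seqs U"
    by (intro UN_least) simp
  then show ?case unfolding sem.simps by (rule order.trans[OF Diff_subset])
qed (auto split: if_splits)

text \<open>
  A sum of truth values can be \<open>1\<close> although no summand is; but the disjuncts of \<open>\<phi>\<^sup>Q\<close> take only the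
  values \<open>0\<close> and \<open>1\<close>, so that one of them has the value \<open>1\<close> where the disjunction has.
\<close>

lemma sem_relativize:
  fixes \<phi> :: "('m::{finite,de_morgan_algebra}, 'i) fm"
  shows "sem U P (relativize Q \<phi>) 1 \<subseteq> (\<Union>p\<in>Q. sem U P \<phi> p)"
proof -
  have "sem U P (or_list (map (\<lambda>p. Gam p \<phi>) ps)) 1 \<subseteq> (\<Union>p\<in>set ps. sem U P \<phi> p)" for ps
  proof (induction ps rule: induct_list012)
    case (3 p p' ps)
    show ?case
    proof
      fix s assume "s \<in> sem U P (or_list (map (\<lambda>p. Gam p \<phi>) (p # p' # ps))) 1"
      then obtain q r where qr: "q + r = 1" "s \<in> sem U P (Gam p \<phi>) q"
        "s \<in> sem U P (or_list (map (\<lambda>p. Gam p \<phi>) (p' # ps))) r"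
        by auto
      then consider "s \<in> sem U P \<phi> p" | "q = 0" by (auto split: if_splits)
      then show "s \<in> (\<Union>p\<in>set (p # p' # ps). sem U P \<phi> p)"
      proof cases
        case 2
        then show ?thesis using qr 3 by fastforce
      qed simp
    qed
  qed auto
  then show ?thesis unfolding relativize_def BigOr_def using listing_set(2)[of Q] by fastforce
qed

text \<open>
  From \<open>t\<^sub>0\<close> everything is derivable, also \<open>t\<^sub>0\<^sup>Q\<close>; thus \<open>Q\<close>-consistency of \<open>\<Sigma>\<close> implies consistency of \<open>\<Sigma>\<^sup>Q\<close>.
\<close>

lemma Q_consistent_has_model:
  fixes \<Sigma> :: "('m::{finite,de_morgan_algebra}, 'i) fm set"
  assumes \<Sigma>: "\<And>\<phi>. \<phi> \<in> \<Sigma> \<Longrightarrow> is_formula ar \<phi>" and "Q_consistent ar Q \<Sigma>"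
  shows "\<exists>(U :: ('m, 'i) fm set) P. is_Q_model ar Q U P \<Sigma>"
proof -
  have f: "is_formula ar (relativize Q \<phi>)" if "is_formula ar \<phi>" for \<phi> :: "('m, 'i) fm"
    using that by (simp add: relativize_def formula_BigOr)
  have "consistent ar (relativize Q ` \<Sigma>)"
    unfolding consistent_def
  proof
    assume "derives ar (relativize Q ` \<Sigma>) (Val 0)"
    then have "derives ar (relativize Q ` \<Sigma>) (relativize Q (Val 0))"
      by (intro derives_consequence[of "[Val 0]"]) (simp_all add: f)
    then show False using assms(2) by (simp add: Q_consistent_def Q_derives_def)
  qed
  then obtain U :: "('m, 'i) fm set" and P where "is_model ar U P (relativize Q ` \<Sigma>)"
    using consistent_has_model[of "relativize Q ` \<Sigma>" ar] \<Sigma> f by blast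
  then have "is_structure ar U P" "\<And>\<phi>. \<phi> \<in> \<Sigma> \<Longrightarrow> sem U P (relativize Q \<phi>) 1 = seqs U"
    by (auto simp: is_model_def true_in_def)
  then have "is_Q_model ar Q U P \<Sigma>"
    using sem_relativize[of U P Q] sem_subset[of U P] unfolding is_Q_model_def Q_true_in_def by blast
  then show ?thesis by blast
qed

theorem theorem3p41:
  fixes ar :: "'i \<Rightarrow> nat"
  shows
    "(\<forall>\<Sigma> :: ('m::{finite, de_morgan_algebra}, 'i) fm set.
        (\<forall>\<phi>\<in>\<Sigma>. is_formula ar \<phi>) \<longrightarrow> consistent ar \<Sigma> \<longrightarrow>
        (\<exists>(U :: ('m, 'i) fm set) P. is_model ar U P \<Sigma>)) \<and>
     (\<forall>(Q :: 'm set) (\<Sigma> :: ('m, 'i) fm set).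
        (\<forall>\<phi>\<in>\<Sigma>. is_formula ar \<phi>) \<longrightarrow> Q_consistent ar Q \<Sigma> \<longrightarrow>
        (\<exists>(U :: ('m, 'i) fm set) P. is_Q_model ar Q U P \<Sigma>))"
  by (intro conjI allI impI consistent_has_model Q_consistent_has_model) auto

end
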